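(* For all integers $n \geq 10$, $\overline{a}(n)^2 > \overline{a}(n+1)\, \overline{a}(n-1)$.
   Context: The cubic overpartition function $\overline{a}(n)$ is defined by $\sum_{n\ge 0}\overline{a}(n)q^n=\frac{(-q;q)_\infty(-q^2;q^2)_\infty}{(q;q)_\infty(q^2;q^2)_\infty}$ for $|q|<1$, where $(a;q)_\infty=\prod_{j\ge 0}(1-aq^j)$. *)

theory Defs
  imports "HOL-Analysis.Analysis"
begin

definition qpoch_inf :: "real \<Rightarrow> real \<Rightarrow> real" where
  "qpoch_inf a q = (\<Prod>j. 1 - a * q ^ j)"

definition cubic_gf :: "real \<Rightarrow> real" where
  "cubic_gf q = qpoch_inf (-q) q * qpoch_inf (-(q^2)) (q^2)
                / (qpoch_inf q q * qpoch_inf (q^2) (q^2))"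

definition cubic_overpartition :: "nat \<Rightarrow> real" where
  "cubic_overpartition = (THE a. \<forall>q::real. \<bar>q\<bar> < 1 \<longrightarrow> (\<lambda>n. a n * q ^ n) sums cubic_gf q)"

end

theory Submission
  imports Defs "HOL-Complex_Analysis.Complex_Analysis"
begin

text \<open>
  The generating function is exp (L q), where L has nonnegative coefficients l(k), and a(n) satisfies
  log-concavity at n as soon as a(n+1) r^(n+1) + a(n-1) r^(n-1) < 2 a(n) r^n for a single r
  in (0,1), by the inequality of arithmetic and geometric means. By Cauchy's formula the difference of
  the two sides is a positive multiple of the integral over [0,pi] of
  exp (-R x) cos (\<eta> x) (1 - cos x), where R x = L r - Re (L (r e^(ix))) and
  \<eta> x = Im (L (r e^(ix))) - n x.

  Choose r = e^(-t) as the saddle point, where the sum of k l(k) r^k equals n. Then R x is at most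
  (15/4) x^2/t^3 and \<eta> x is O(x^3/t^4), so that the part of the integral with x at most t^(3/2) is
  positive and of order t^(9/2). For larger x, already the leading terms of the Lambert series for L
  make exp (-R x) small enough. Only elementary bounds for the moments of l(k) are used, and no
  modular transformation. The constants suffice for t at most 1/10, which covers n at least 375; the
  smaller n are checked with exact values, obtained from the (very small) coefficients of exp (-L q).
\<close>

text \<open>Tilting by r replaces a comparison of three asymptotics by the sign of one integral. The
  saddle point equation is there to cancel the linear term of the phase \<open>\<eta>\<close>, which
  is why \<open>\<eta>\<close> is cubic in x. The radius t^(3/2) is the natural width of the peak,
  because the second moment of l(k) r^k has order 1/t^3. With x = y t^(3/2), the squared phase is at
  most (35/8)^2 t y^6. The lower bound 1 - \<open>\<eta>\<close>^2/2 for the cosine therefore stays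
  positive up to y = 1 only if t < 128/1225, about 0.1045; this dictates t <= 1/10. The first moment
  bound n <= 15/(4 t^2) then turns 1/10 into the threshold 375. In units of t^(9/2) the gain is
  about 0.0214 and the losses are at most 0.019, so the constants cannot be much cruder. The
  coefficients of exp (-L q) are small for a reason: by Gauss's identity this series is the product
  of the theta series of (-1)^x q^(x^2) and (-1)^y q^(2 y^2), so they are signed counts of the
  representations of n by x^2 + 2 y^2. The proof computes them without this identity.\<close>

section \<open>Moments of the Lambert coefficients\<close>

text \<open>
  In the next three proofs, g i is the closed form of the tail, that is, of the sum of
  (i + l)^j x^l over all l, so that the partial sums telescope.
\<close>

lemma sum_linear_power_le:
  fixes x :: real
  assumes "0 \<le> x" "x < 1"
  shows "(\<Sum>i<K. real i * x ^ i) \<le> x / (1 - x) ^ 2"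
proof -
  define d where "d = 1 - x"
  have d: "d > 0" "x = 1 - d" using assms by (auto simp: d_def)
  define g where "g i = real i / d + x / d ^ 2" for i
  have step: "real i * x ^ i = g i * x ^ i - g (Suc i) * x ^ Suc i" for i
  proof -
    have "g i - g (Suc i) * x = real i"
      using d(1) by (simp add: g_def d(2) field_simps power2_eq_square)
    then show ?thesis by (simp add: algebra_simps flip: distrib_left)
  qed
  have "(\<Sum>i<K. real i * x ^ i) = g 0 - g K * x ^ K"
    by (induction K) (simp_all add: step)
  moreover have "0 \<le> g K * x ^ K" using assms d by (simp add: g_def)
  ultimately show ?thesis by (simp add: g_def d_def)
qed

lemma sum_square_power_le:
  fixes x :: real
  assumes "0 \<le> x" "x < 1"
  shows "(\<Sum>i<K. real i ^ 2 * x ^ i) \<le> x * (1 + x) / (1 - x) ^ 3"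
proof -
  define d where "d = 1 - x"
  have d: "d > 0" "x = 1 - d" using assms by (auto simp: d_def)
  define g where "g i = real i ^ 2 / d + 2 * real i * x / d ^ 2 + x * (1 + x) / d ^ 3" for i
  have step: "real i ^ 2 * x ^ i = g i * x ^ i - g (Suc i) * x ^ Suc i" for i
  proof -
    have "g i - g (Suc i) * x = real i ^ 2"
      using d(1) by (simp add: g_def d(2) field_simps power2_eq_square power3_eq_cube)
    then show ?thesis by (simp add: algebra_simps flip: distrib_left)
  qed
  have "(\<Sum>i<K. real i ^ 2 * x ^ i) = g 0 - g K * x ^ K"
    by (induction K) (simp_all add: step)
  moreover have "0 \<le> g K * x ^ K" using assms d by (simp add: g_def)
  ultimately show ?thesis by (simp add: g_def d_def)
qed

lemma sum_cube_power_le: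
  fixes x :: real
  assumes "0 \<le> x" "x < 1"
  shows "(\<Sum>i<K. real i ^ 3 * x ^ i) \<le> x * (1 + 4 * x + x ^ 2) / (1 - x) ^ 4"
proof -
  define d where "d = 1 - x"
  have d: "d > 0" "x = 1 - d" using assms by (auto simp: d_def)
  define g where "g i = real i ^ 3 / d + 3 * real i ^ 2 * x / d ^ 2 + 3 * real i * x * (1 + x) / d ^ 3
     + x * (1 + 4 * x + x ^ 2) / d ^ 4" for i
  have step: "real i ^ 3 * x ^ i = g i * x ^ i - g (Suc i) * x ^ Suc i" for i
  proof -
    have "g i - g (Suc i) * x = real i ^ 3"
      using d(1) by (simp add: g_def d(2) field_simps eval_nat_numeral)
    then show ?thesis by (simp add: algebra_simps flip: distrib_left)
  qed
  have "(\<Sum>i<K. real i ^ 3 * x ^ i) = g 0 - g K * x ^ K"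
    by (induction K) (simp_all add: step)
  moreover have "0 \<le> g K * x ^ K" using assms d by (simp add: g_def)
  ultimately show ?thesis by (simp add: g_def d_def)
qed

lemma cosh_ge_poly:
  fixes s :: real
  shows "1 + s ^ 2 / 2 + s ^ 4 / 24 + s ^ 6 / 720 \<le> cosh s"
proof -
  have 1: "(\<lambda>n. if even n then s ^ n /\<^sub>R fact n else 0) sums cosh s" by (rule cosh_converges)
  have "(\<Sum>n<7. if even n then s ^ n /\<^sub>R fact n else 0) \<le> (\<Sum>n. if even n then s ^ n /\<^sub>R fact n else 0)"
    by (rule sum_le_suminf) (use 1 sums_summable in \<open>auto simp: zero_le_power_eq\<close>)
  also have "\<dots> = cosh s" using 1 by (simp add: sums_iff)
  finally show ?thesis by (simp add: lessThan_nat_numeral lessThan_Suc fact_numeral field_simps)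
qed

text \<open>With x = e^(-s), the closed forms depend on x only through p = (1 - x)^2/x = 2 cosh s -
  2: they are 1/p, the root of (p + 4)/p^3, and (p + 6)/p^2. Lower bounds for cosh then suffice. The
  constants 1 and 2 are the limits as s tends to 0; for cubes the limit 6 fails, since the full sum
  is 6/s^4 + 1/120 + O(s), hence 7.\<close>

lemma exp_power_moment_bounds:
  fixes s :: real
  assumes "s > 0"
  shows "(\<Sum>i<K. real i * exp (- s) ^ i) \<le> 1 / s ^ 2"
    and "(\<Sum>i<K. real i ^ 2 * exp (- s) ^ i) \<le> 2 / s ^ 3"
    and "(\<Sum>i<K. real i ^ 3 * exp (- s) ^ i) \<le> 7 / s ^ 4"
proof -
  define x where "x = exp (- s)"
  have x: "0 < x" "x < 1" using assms by (auto simp: x_def)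
  define p where "p = 2 * cosh s - 2"
  define y where "y = s ^ 2"
  have y: "y > 0" using assms by (simp add: y_def)
  have xinv: "exp s = 1 / x" by (simp add: x_def exp_minus field_simps)
  have xp: "(1 - x) ^ 2 = x * p" using x
    by (simp add: p_def cosh_def xinv flip: x_def) (simp add: field_simps power2_eq_square)
  have p: "p \<ge> y * (1 + y / 12 + y ^ 2 / 360)"
    using cosh_ge_poly[of s] by (simp add: p_def y_def field_simps eval_nat_numeral)
  have py: "p \<ge> y" "p > 0" 
  proof -
    have "y * 1 \<le> y * (1 + y / 12 + y ^ 2 / 360)" using y by (intro mult_left_mono) auto
    then show "p \<ge> y" "p > 0" using p y by linarith+
  qed
  have "(\<Sum>i<K. real i * x ^ i) \<le> x / (1 - x) ^ 2" by (rule sum_linear_power_le) (use x in auto)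
  also have "\<dots> = 1 / p" using x xp by simp
  also have "\<dots> \<le> 1 / s ^ 2" using py y by (simp add: frac_le flip: y_def)
  finally show "(\<Sum>i<K. real i * exp (- s) ^ i) \<le> 1 / s ^ 2" by (simp add: x_def)
  have "(\<Sum>i<K. real i ^ 3 * x ^ i) \<le> x * (1 + 4 * x + x ^ 2) / (1 - x) ^ 4" by (rule sum_cube_power_le) (use x in auto)
  also have "\<dots> = x * ((1 - x) ^ 2 + 6 * x) / ((1 - x) ^ 2) ^ 2"
    by (simp add: algebra_simps power2_eq_square eval_nat_numeral)
  also have "\<dots> = (p + 6) / p ^ 2" unfolding xp using x py(2) by (simp add: divide_simps) (simp add: algebra_simps power2_eq_square)
  also have "\<dots> \<le> 7 / y ^ 2"
  proof -
    define v where "v = p / y"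
    have v: "p = y * v" "v \<ge> 1 + y / 12 + y ^ 2 / 360" using y p by (auto simp: v_def field_simps)
    define v1 where "v1 = 1 + y / 12 + y ^ 2 / 360"
    have v1: "v1 > 0" unfolding v1_def using y by (intro add_pos_nonneg) auto
    have v1': "14 * v1 \<ge> y" unfolding v1_def using y zero_le_power2[of y] by argo
    \<comment> \<open>The coefficient of y^2 is positive only thanks to the term y^2/360 of
      \<open>v1\<close>, that is, to the sixth-degree term of cosh.\<close>
    have "7 * v1 ^ 2 - y * v1 - 6 = 1 + y / 6 + y\<^sup>2 / 240 + y ^ 3 / 2160 + 7 * y ^ 4 / 129600"
      by (simp add: v1_def field_simps eval_nat_numeral)
    then have "7 * v1 ^ 2 - y * v1 - 6 \<ge> 0" using y by simp
    \<comment> \<open>This product is the increase of 7 v^2 - y v - 6 from \<open>v1\<close> to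
      \<open>v\<close>.\<close>
    moreover have "(v - v1) * (7 * v + 7 * v1 - y) \<ge> 0"
      using v v1 v1' by (intro mult_nonneg_nonneg) (auto simp: v1_def)
    ultimately have "y * v + 6 \<le> 7 * v ^ 2" by (simp add: algebra_simps power2_eq_square)
    then have "(y * v + 6) * y ^ 2 \<le> 7 * v ^ 2 * y ^ 2" by (rule mult_right_mono) simp
    moreover have "v > 0" using v(2) v1 by (simp add: v1_def)
    ultimately show ?thesis using y by (simp add: v(1) field_simps power_mult_distrib)
  qed
  finally show "(\<Sum>i<K. real i ^ 3 * exp (- s) ^ i) \<le> 7 / s ^ 4" by (simp add: x_def y_def)
  have "(\<Sum>i<K. real i ^ 2 * x ^ i) \<le> x * (1 + x) / (1 - x) ^ 3" by (rule sum_square_power_le) (use x in auto)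
  also have "\<dots> \<le> 2 / s ^ 3"
  \<comment> \<open>The power of 1 - x is odd here, so p appears only after squaring.\<close>
  proof (rule power2_le_imp_le)
    have "(x * (1 + x) / (1 - x) ^ 3) ^ 2 = x ^ 2 * ((1 - x) ^ 2 + 4 * x) / ((1 - x) ^ 2) ^ 3"
      by (simp add: power_divide power_mult_distrib) (simp add: algebra_simps power2_eq_square)
    also have "\<dots> = (p + 4) / p ^ 3" unfolding xp using x py(2)
      by (simp add: divide_simps) (simp add: algebra_simps eval_nat_numeral)
    also have "\<dots> \<le> 4 / y ^ 3"
    proof -
      define v where "v = p / y"
      have v': "p = y * v" "v \<ge> 1 + y / 12 + y ^ 2 / 360" using y p by (auto simp: v_def field_simps)
      have "0 \<le> y ^ 2 / 360" by simp
      then have v: "p = y * v" "v \<ge> 1 + y / 12" using v' by linarith+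
      have v1: "v \<ge> 1" using v y by simp
      have "y * v \<le> 12 * (v - 1) * v" using v v1 by (intro mult_right_mono) auto
      also have "\<dots> \<le> 4 * v ^ 3 - 4"
      proof -
        have "4 * v ^ 3 - 4 - 12 * (v - 1) * v = 4 * (v - 1) * (v - 1) ^ 2"
          by (simp add: algebra_simps eval_nat_numeral)
        moreover have "\<dots> \<ge> 0" using v1 by simp
        ultimately show ?thesis by linarith
      qed
      finally have "(y * v + 4) * y ^ 3 \<le> 4 * v ^ 3 * y ^ 3" using y by (intro mult_right_mono) auto
      then show ?thesis using y v1 by (simp add: v(1) field_simps power_mult_distrib)
    qed
    also have "\<dots> = (2 / s ^ 3) ^ 2" by (simp add: y_def power_divide)
    finally show "(x * (1 + x) / (1 - x) ^ 3) ^ 2 \<le> (2 / s ^ 3) ^ 2" .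
  qed (use assms in auto)
  finally show "(\<Sum>i<K. real i ^ 2 * exp (- s) ^ i) \<le> 2 / s ^ 3" by (simp add: x_def)
qed

text \<open>For k = 0 the index set is infinite, so that the sum is 0.\<close>

definition lam :: "nat \<Rightarrow> real" where
  "lam k = (\<Sum>m | m dvd k \<and> odd m. 2 / real m)"

text \<open>The coefficient l(k) of the logarithm of the generating function. The factor in q
  contributes \<open>lam k\<close>, the factor in q^2 the same sequence at even indices.\<close>

definition lcf :: "nat \<Rightarrow> real" where
  "lcf k = lam k + (if even k then lam (k div 2) else 0)"

lemma lam_0 [simp]: "lam 0 = 0"
proof -
  have "infinite {m. odd (m::nat)}"
    unfolding infinite_nat_iff_unbounded by (metis even_Suc lessI mem_Collect_eq Suc_lessD)
  then show ?thesis by (simp add: lam_def)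
qed

lemma lam_nonneg: "0 \<le> lam k"
  by (auto simp: lam_def intro!: sum_nonneg)

lemma lam_ge_2:
  assumes "k > 0" shows "2 \<le> lam k"
proof -
  have "(\<Sum>m\<in>{1}. 2 / real m) \<le> lam k" unfolding lam_def
    by (rule sum_mono2) (use assms in auto)
  then show ?thesis by simp
qed

lemma lcf_0 [simp]: "lcf 0 = 0" by (simp add: lcf_def)

lemma lcf_nonneg: "0 \<le> lcf k" by (simp add: lcf_def lam_nonneg)

text \<open>The full sum is pi^2/8, about 1.234. Beyond m = 1, the estimate 1/(2n+1)^2 < 1/(4n) -
  1/(4(n+1)) telescopes to at most 1/4.\<close>

lemma sum_odd_inverse_squares_le: "(\<Sum>m | m < K \<and> odd m. 1 / real m ^ 2) \<le> 5 / 4"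
proof -
  have 1: "(\<Sum>j<n. 1 / (2 * real j + 1) ^ 2) \<le> 5 / 4 - (if n = 0 then 1/4 else 1 / (4 * real n))" for n
  proof (induction n)
    case (Suc n)
    show ?case
    proof (cases "n = 0")
      case False
      have "1 / (2 * real n + 1) ^ 2 \<le> 1 / (4 * real n) - 1 / (4 * real (Suc n))"
        using False by (simp add: divide_simps) (simp add: algebra_simps power2_eq_square)
      then show ?thesis using Suc False by simp
    qed (use Suc in auto)
  qed auto
  have "(\<Sum>m | m < K \<and> odd m. 1 / real m ^ 2) \<le> (\<Sum>m\<in>(\<lambda>j. 2 * j + 1) ` {..<K}. 1 / real m ^ 2)"
    by (rule sum_mono2) (auto elim!: oddE)
  also have "\<dots> = (\<Sum>j<K. 1 / (2 * real j + 1) ^ 2)"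
    by (subst sum.reindex) (auto simp: inj_on_def add_ac)
  also have "\<dots> \<le> 5 / 4 - (if K = 0 then 1/4 else 1 / (4 * real K))" by (rule 1)
  also have "\<dots> \<le> 5 / 4" by simp
  finally show ?thesis .
qed

lemma sum_divisors_swap:
  fixes f :: "nat \<Rightarrow> nat \<Rightarrow> real"
  shows "(\<Sum>k\<in>{1..<K}. \<Sum>m | m dvd k \<and> odd m. f m k) = (\<Sum>m | m < K \<and> odd m. \<Sum>k | k \<in> {1..<K} \<and> m dvd k. f m k)"
proof -
  have "(\<Sum>k\<in>{1..<K}. \<Sum>m | m dvd k \<and> odd m. f m k) = (\<Sum>k\<in>{1..<K}. \<Sum>m | m \<in> {m. m < K \<and> odd m} \<and> m dvd k. f m k)"
    by (intro sum.cong refl) (auto dest: dvd_imp_le)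
  also have "\<dots> = (\<Sum>m | m < K \<and> odd m. \<Sum>k | k \<in> {1..<K} \<and> m dvd k. f m k)"
    by (rule sum.swap_restrict) auto
  finally show ?thesis .
qed

text \<open>Writing k = m i turns the part belonging to m into 2 m^(j-1) times a plain moment at s =
  m t. By the assumed bound this is at most 2 B/t^(j+1) times 1/m^2, and the sum over odd m costs
  the factor 5/4.\<close>

lemma lam_moment_le:
  fixes t B :: real
  assumes bound: "\<And>s K. s > 0 \<Longrightarrow> (\<Sum>i<K. real i ^ j * exp (- s) ^ i) \<le> B / s ^ Suc j"
  assumes "t > 0" "j > 0" "B \<ge> 0"
  shows "(\<Sum>k<K. lam k * real k ^ j * exp (- t) ^ k) \<le> 5 / 2 * B / t ^ Suc j"
proof -
  have "(\<Sum>k<K. lam k * real k ^ j * exp (- t) ^ k) = (\<Sum>k\<in>{1..<K}. lam k * real k ^ j * exp (- t) ^ k)"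
    by (rule sum.mono_neutral_right) (auto simp: Suc_le_eq)
  also have "\<dots> = (\<Sum>k\<in>{1..<K}. \<Sum>m | m dvd k \<and> odd m. 2 / real m * (real k ^ j * exp (- t) ^ k))"
    by (simp add: lam_def sum_distrib_left sum_distrib_right mult_ac)
  also have "\<dots> = (\<Sum>m | m < K \<and> odd m. \<Sum>k | k \<in> {1..<K} \<and> m dvd k. 2 / real m * (real k ^ j * exp (- t) ^ k))"
    by (rule sum_divisors_swap)
  also have "\<dots> \<le> (\<Sum>m | m < K \<and> odd m. 2 * B / t ^ Suc j * (1 / real m ^ 2))"
  proof (rule sum_mono)
    fix m assume "m \<in> {m. m < K \<and> odd m}"
    then have m: "m < K" "m > 0" by (auto simp: odd_pos)
    have "(\<Sum>k | k \<in> {1..<K} \<and> m dvd k. 2 / real m * (real k ^ j * exp (- t) ^ k))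
       \<le> (\<Sum>k\<in>(\<lambda>i. m * i) ` {..<K}. 2 / real m * (real k ^ j * exp (- t) ^ k))"
    proof (rule sum_mono2)
      show "{k \<in> {1..<K}. m dvd k} \<subseteq> (*) m ` {..<K}"
      proof
        fix k assume "k \<in> {k \<in> {1..<K}. m dvd k}"
        then obtain i where i: "k = m * i" "k < K" by auto
        have "i \<le> m * i" using m by simp
        then have "i < K" using i by linarith
        then show "k \<in> (*) m ` {..<K}" using i by auto
      qed
    qed auto
    also have "\<dots> = (\<Sum>i<K. 2 / real m * (real (m * i) ^ j * exp (- t) ^ (m * i)))"
      by (subst sum.reindex) (use m in \<open>auto simp: inj_on_def\<close>)
    also have "\<dots> = 2 / real m * real m ^ j * (\<Sum>i<K. real i ^ j * exp (- (m * t)) ^ i)"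
      by (simp add: sum_distrib_left power_mult_distrib power_mult mult_ac flip: exp_of_nat_mult)
    also have "\<dots> \<le> 2 / real m * real m ^ j * (B / (m * t) ^ Suc j)"
      by (intro mult_left_mono bound) (use m assms in auto)
    also have "\<dots> = 2 * B / t ^ Suc j * (1 / real m ^ 2)"
      using m by (simp add: power_mult_distrib field_simps power2_eq_square)
    finally show "(\<Sum>k | k \<in> {1..<K} \<and> m dvd k. 2 / real m * (real k ^ j * exp (- t) ^ k)) \<le> 2 * B / t ^ Suc j * (1 / real m ^ 2)" .
  qed
  also have "\<dots> = 2 * B / t ^ Suc j * (\<Sum>m | m < K \<and> odd m. 1 / real m ^ 2)"
    by (simp add: sum_distrib_left)
  also have "\<dots> \<le> 2 * B / t ^ Suc j * (5 / 4)"
    by (intro mult_left_mono sum_odd_inverse_squares_le) (use assms in auto)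
  finally show ?thesis by simp
qed

text \<open>The even indices k = 2 i give 2^j times a moment at 2 t, which is bounded by half the
  bound for \<open>lam\<close>; so 5/2 becomes 15/4.\<close>

lemma lcf_moment_le:
  fixes t B :: real
  assumes bound: "\<And>s K. s > 0 \<Longrightarrow> (\<Sum>i<K. real i ^ j * exp (- s) ^ i) \<le> B / s ^ Suc j"
  assumes "t > 0" "j > 0" "B \<ge> 0"
  shows "(\<Sum>k<K. lcf k * real k ^ j * exp (- t) ^ k) \<le> 15 / 4 * B / t ^ Suc j"
proof -
  have "(\<Sum>k<K. lcf k * real k ^ j * exp (- t) ^ k) = (\<Sum>k<K. lam k * real k ^ j * exp (- t) ^ k)
     + (\<Sum>k<K. if even k then lam (k div 2) * real k ^ j * exp (- t) ^ k else 0)"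
    unfolding sum.distrib[symmetric] by (intro sum.cong) (auto simp: lcf_def algebra_simps)
  also have "(\<Sum>k<K. if even k then lam (k div 2) * real k ^ j * exp (- t) ^ k else 0) =
     (\<Sum>k | k < K \<and> even k. lam (k div 2) * real k ^ j * exp (- t) ^ k)"
    by (subst sum.inter_filter[symmetric]) auto
  also have "\<dots> \<le> (\<Sum>k\<in>(\<lambda>i. 2 * i) ` {..<K}. lam (k div 2) * real k ^ j * exp (- t) ^ k)"
    by (rule sum_mono2) (auto elim!: evenE intro!: mult_nonneg_nonneg lam_nonneg)
  also have "\<dots> = (\<Sum>i<K. lam i * real (2 * i) ^ j * exp (- t) ^ (2 * i))"
    by (subst sum.reindex) (auto simp: inj_on_def)
  also have "\<dots> = 2 ^ j * (\<Sum>i<K. lam i * real i ^ j * exp (- (2 * t)) ^ i)"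
    by (simp add: sum_distrib_left power_mult_distrib mult_ac flip: exp_of_nat_mult)
  also have "\<dots> \<le> 2 ^ j * (5 / 2 * B / (2 * t) ^ Suc j)"
    by (intro mult_left_mono lam_moment_le) (use assms in auto)
  also have "\<dots> = 5 / 4 * B / t ^ Suc j"
    by (simp add: power_mult_distrib field_simps)
  also have "(\<Sum>k<K. lam k * real k ^ j * exp (- t) ^ k) \<le> 5 / 2 * B / t ^ Suc j"
    by (rule lam_moment_le) (use assms in auto)
  finally show ?thesis by (simp add: field_simps)
qed

section \<open>The logarithm of the generating function\<close>

lemma sum_lcf_moment_le:
  assumes "t > 0"
  shows "(\<Sum>k<K. lcf k * real k * exp (- t) ^ k) \<le> 15 / 4 / t ^ 2"
    and "(\<Sum>k<K. lcf k * real k ^ 2 * exp (- t) ^ k) \<le> 15 / 2 / t ^ 3"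
    and "(\<Sum>k<K. lcf k * real k ^ 3 * exp (- t) ^ k) \<le> 105 / 4 / t ^ 4"
proof -
  have "(\<Sum>k<K. lcf k * real k ^ 1 * exp (- t) ^ k) \<le> 15 / 4 * 1 / t ^ Suc 1"
    by (rule lcf_moment_le) (use exp_power_moment_bounds(1) assms in \<open>simp_all add: power2_eq_square\<close>)
  then show "(\<Sum>k<K. lcf k * real k * exp (- t) ^ k) \<le> 15 / 4 / t ^ 2" by (simp add: power2_eq_square)
  have "(\<Sum>k<K. lcf k * real k ^ 2 * exp (- t) ^ k) \<le> 15 / 4 * 2 / t ^ Suc 2"
    by (rule lcf_moment_le) (use exp_power_moment_bounds(2) assms in \<open>simp_all add: eval_nat_numeral\<close>)
  then show "(\<Sum>k<K. lcf k * real k ^ 2 * exp (- t) ^ k) \<le> 15 / 2 / t ^ 3" by (simp add: eval_nat_numeral)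
  have "(\<Sum>k<K. lcf k * real k ^ 3 * exp (- t) ^ k) \<le> 15 / 4 * 7 / t ^ Suc 3"
    by (rule lcf_moment_le) (use exp_power_moment_bounds(3) assms in \<open>simp_all add: eval_nat_numeral\<close>)
  then show "(\<Sum>k<K. lcf k * real k ^ 3 * exp (- t) ^ k) \<le> 105 / 4 / t ^ 4" by (simp add: eval_nat_numeral)
qed

lemma summable_lcf_moment:
  assumes "0 \<le> r" "r < 1" "j \<le> 3"
  shows "summable (\<lambda>k. lcf k * real k ^ j * r ^ k)"
proof -
  have main: "summable (\<lambda>k. lcf k * real k ^ 3 * r ^ k)"
  proof (cases "r = 0")
    case True
    then show ?thesis by (intro summable_finite[of "{0}"]) auto
  next
    case False
    define t where "t = - ln r"
    have t: "t > 0" "r = exp (- t)" using assms False by (auto simp: t_def)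
    show ?thesis
    proof (rule bounded_imp_summable)
      show "0 \<le> lcf k * real k ^ 3 * r ^ k" for k using assms lcf_nonneg[of k] by simp
      show "(\<Sum>k\<le>n. lcf k * real k ^ 3 * r ^ k) \<le> 105 / 4 / t ^ 4" for n
        using sum_lcf_moment_le(3)[OF t(1), of "Suc n"] unfolding t(2) lessThan_Suc_atMost .
    qed
  qed
  show ?thesis
  proof (rule summable_comparison_test'[OF main, of 0])
    fix k :: nat
    have "real k ^ j \<le> real k ^ 3" if "k > 0" using that assms by (intro power_increasing) auto
    then show "norm (lcf k * real k ^ j * r ^ k) \<le> lcf k * real k ^ 3 * r ^ k"
      using lcf_nonneg[of k] assms
      by (cases "k = 0") (auto simp: abs_mult intro!: mult_right_mono mult_left_mono)
  qed
qed

lemma suminf_lcf_moment_le: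
  assumes "t > 0"
  shows "(\<Sum>k. lcf k * real k * exp (- t) ^ k) \<le> 15 / 4 / t ^ 2"
    and "(\<Sum>k. lcf k * real k ^ 2 * exp (- t) ^ k) \<le> 15 / 2 / t ^ 3"
    and "(\<Sum>k. lcf k * real k ^ 3 * exp (- t) ^ k) \<le> 105 / 4 / t ^ 4"
proof -
  have r: "0 \<le> exp (- t)" "exp (- t) < 1" using assms by auto
  note s = summable_lcf_moment[OF r]
  show "(\<Sum>k. lcf k * real k * exp (- t) ^ k) \<le> 15 / 4 / t ^ 2"
    using s[of 1] sum_lcf_moment_le(1)[OF assms] by (intro suminf_le_const) simp_all
  show "(\<Sum>k. lcf k * real k ^ 2 * exp (- t) ^ k) \<le> 15 / 2 / t ^ 3"
    using s[of 2] sum_lcf_moment_le(2)[OF assms] by (intro suminf_le_const) simp_all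
  show "(\<Sum>k. lcf k * real k ^ 3 * exp (- t) ^ k) \<le> 105 / 4 / t ^ 4"
    using s[of 3] sum_lcf_moment_le(3)[OF assms] by (intro suminf_le_const) simp_all
qed

text \<open>Even powers cancel in ln (1 + x) - ln (1 - x). The form with \<open>has_sum\<close> is
  needed because \<open>ln_ratio_sums_lam\<close> rearranges a double sum.\<close>

lemma ln_ratio_has_sum:
  fixes x :: real
  assumes "\<bar>x\<bar> < 1"
  shows "((\<lambda>m. 2 / real m * x ^ m) has_sum ln ((1 + x) / (1 - x))) {m. odd m}"
proof -
  have s1: "(\<lambda>n. - ((- x) ^ n) / real n) sums ln (1 + x)" using ln_series'[of x] assms by simp
  have s2: "(\<lambda>n. - (x ^ n) / real n) sums ln (1 - x)" using ln_series'[of "- x"] assms by simp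
  have ln: "ln ((1 + x) / (1 - x)) = ln (1 + x) - ln (1 - x)" using assms by (intro ln_divide_pos) auto
  have "(\<lambda>n. - ((- x) ^ n) / real n - - (x ^ n) / real n) sums (ln (1 + x) - ln (1 - x))"
    by (rule sums_diff[OF s1 s2])
  also have "(\<lambda>n. - ((- x) ^ n) / real n - - (x ^ n) / real n) = (\<lambda>n. if odd n then 2 / real n * x ^ n else 0)"
    by (rule ext) (auto simp: field_simps)
  finally have s: "(\<lambda>n. if odd n then 2 / real n * x ^ n else 0) sums ln ((1 + x) / (1 - x))"
    by (simp add: ln)
  have "summable (\<lambda>n. norm (if odd n then 2 / real n * x ^ n else 0))"
  proof (rule summable_comparison_test')
    show "summable (\<lambda>n. 2 * \<bar>x\<bar> ^ n)" using assms by (intro summable_mult summable_geometric) auto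
    fix n :: nat
    show "norm (norm (if odd n then 2 / real n * x ^ n else 0)) \<le> 2 * \<bar>x\<bar> ^ n"
      using mult_right_mono[of 1 "real n" "\<bar>x\<bar> ^ n"]
      by (cases "n = 0") (auto simp: abs_mult power_abs field_simps)
  qed
  then have "((\<lambda>n. if odd n then 2 / real n * x ^ n else 0) has_sum ln ((1 + x) / (1 - x))) UNIV"
    using s by (rule norm_summable_imp_has_sum)
  then show ?thesis by (subst (asm) has_sum_cong_neutral[where T = "{m. odd m}"]) auto
qed

lemma summable_lam:
  assumes "\<bar>q\<bar> < 1"
  shows "summable (\<lambda>k. norm (lam k * q ^ k))"
proof (rule summable_comparison_test')
  show "summable (\<lambda>k. lcf k * real k ^ 0 * \<bar>q\<bar> ^ k)" using assms by (intro summable_lcf_moment) auto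
  show "norm (norm (lam k * q ^ k)) \<le> lcf k * real k ^ 0 * \<bar>q\<bar> ^ k" for k
    using lam_nonneg[of k] lam_nonneg[of "k div 2"]
    by (auto simp: abs_mult power_abs lcf_def intro!: mult_right_mono)
qed

text \<open>Both sides are the sum of 2 q^(im) / m over all i > 0 and odd m.\<close>
lemma ln_ratio_sums_lam:
  fixes q :: real
  assumes q: "\<bar>q\<bar> < 1"
  shows "(\<lambda>j. ln ((1 + q ^ Suc j) / (1 - q ^ Suc j))) sums (\<Sum>k. lam k * q ^ k)"
proof -
  define D where "D k = {m::nat. m dvd k \<and> odd m}" for k
  define h where "h = (\<lambda>(k::nat, m::nat). 2 / real m * q ^ k)"
  have fin: "finite (D k)" if "k > 0" for k using that by (auto simp: D_def)
  have lam_eq: "lam k * q ^ k = (\<Sum>m\<in>D k. h (k, m))" for k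
    by (simp add: h_def lam_def D_def sum_distrib_right)
  have norm_eq: "norm (lam k * q ^ k) = (\<Sum>m\<in>D k. norm (h (k, m)))" for k
  proof -
    have "norm (lam k * q ^ k) = lam k * \<bar>q ^ k\<bar>" using lam_nonneg[of k] by (simp add: abs_mult)
    then show ?thesis by (simp add: h_def lam_def D_def sum_distrib_right abs_mult)
  qed
  have U: "((\<lambda>k. lam k * q ^ k) has_sum (\<Sum>k. lam k * q ^ k)) UNIV"
    by (rule norm_summable_imp_has_sum[OF summable_lam[OF q]])
      (use summable_norm_cancel[OF summable_lam[OF q]] in \<open>simp add: summable_sums\<close>)
  then have lamsum: "((\<lambda>k. lam k * q ^ k) has_sum (\<Sum>k. lam k * q ^ k)) {0<..}"
    by (subst (asm) has_sum_cong_neutral[where T = "{0<..}" and g = "\<lambda>k. lam k * q ^ k"]) auto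
  have "(\<lambda>x. norm (h x)) summable_on (Sigma {0<..} D)"
    unfolding Infinite_Sum.abs_summable_on_Sigma_iff
  proof (intro conjI ballI)
    show "(\<lambda>y. norm (h (x, y))) summable_on D x" if "x \<in> {0<..}" for x
      using fin that by (intro summable_on_finite) auto
    have "(\<lambda>k. norm (lam k * q ^ k)) summable_on UNIV"
      using summable_lam[OF q] by (subst summable_on_UNIV_nonneg_real_iff) auto
    then have "(\<lambda>k. norm (lam k * q ^ k)) summable_on {0<..}" 
      by (rule summable_on_subset_banach) auto
    then show "(\<lambda>x. norm (infsum (\<lambda>y. norm (h (x, y))) (D x))) summable_on {0<..}"
      by (subst summable_on_cong[where g = "\<lambda>k. norm (lam k * q ^ k)"]) 
        (auto simp: norm_eq[unfolded real_norm_def] fin sum_nonneg)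
  qed
  then have "h summable_on (Sigma {0<..} D)" by (rule Infinite_Sum.abs_summable_summable)
  then have "(h has_sum (\<Sum>k. lam k * q ^ k)) (Sigma {0<..} D)"
    using lamsum fin by (intro has_sum_SigmaI[where g = "\<lambda>k. lam k * q ^ k"]) 
      (auto simp: lam_eq intro!: has_sum_finite)
  \<comment> \<open>Writing k = i m frees the pairs (i, m) from the divisibility condition; summing
    over m first then gives the logarithm for each i.\<close>
  also have "?this \<longleftrightarrow> ((\<lambda>p. h (fst p * snd p, snd p)) has_sum (\<Sum>k. lam k * q ^ k)) (Sigma {0<..} (\<lambda>_. {m. odd m}))"
    by (rule has_sum_reindex_bij_witness[where i = "\<lambda>p. (fst p * snd p, snd p)" and j = "\<lambda>p. (fst p div snd p, snd p)"])
      (auto simp: D_def odd_pos elim!: dvdE intro: Nat.gr0I)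
  finally have "((\<lambda>i. ln ((1 + q ^ i) / (1 - q ^ i))) has_sum (\<Sum>k. lam k * q ^ k)) {0<..}"
  proof (rule has_sum_SigmaD)
    fix i :: nat assume "i \<in> {0<..}"
    then have "\<bar>q ^ i\<bar> < 1" using q by (auto simp: power_abs power_less_one_iff)
    from ln_ratio_has_sum[OF this]
    show "((\<lambda>y. h (fst (i, y) * snd (i, y), snd (i, y))) has_sum ln ((1 + q ^ i) / (1 - q ^ i))) {m. odd m}"
      by (simp add: h_def power_mult)
  qed
  also have "?this \<longleftrightarrow> ((\<lambda>j. ln ((1 + q ^ Suc j) / (1 - q ^ Suc j))) has_sum (\<Sum>k. lam k * q ^ k)) UNIV"
    by (rule has_sum_reindex_bij_witness[where i = Suc and j = "\<lambda>i. i - 1"]) auto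
  finally show ?thesis by (rule has_sum_imp_sums)
qed

lemma qpoch_inf_ratio:
  assumes q: "\<bar>q\<bar> < 1"
  shows "qpoch_inf (- q) q / qpoch_inf q q = exp (\<Sum>k. lam k * q ^ k)"
proof -
  have abs: "summable (\<lambda>j. \<bar>q ^ Suc j\<bar>)"
    using q by (simp add: abs_mult power_abs summable_mult summable_geometric)
  have conv: "convergent_prod (\<lambda>j. 1 + q ^ Suc j)" "convergent_prod (\<lambda>j. 1 - q ^ Suc j)"
    by (intro abs_convergent_prod_imp_convergent_prod summable_imp_abs_convergent_prod; use abs in simp)+
  have pos: "1 + q ^ Suc j > 0" "1 - q ^ Suc j > 0" for j
  proof -
    have "\<bar>q ^ Suc j\<bar> < 1" using power_le_one[of "\<bar>q\<bar>" j] q mult_left_mono[of "\<bar>q\<bar> ^ j" 1 "\<bar>q\<bar>"]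
      by (simp add: abs_mult power_abs)
    then show "1 + q ^ Suc j > 0" "1 - q ^ Suc j > 0" by linarith+
  qed
  have "qpoch_inf (- q) q / qpoch_inf q q = (\<Prod>j. (1 + q ^ Suc j) / (1 - q ^ Suc j))"
    using prodinf_divide[OF conv] by (simp add: qpoch_inf_def)
  also have "\<dots> = (\<Prod>j. exp (ln ((1 + q ^ Suc j) / (1 - q ^ Suc j))))"
    using pos by (simp del: power_Suc)
  also have "\<dots> = exp (\<Sum>j. ln ((1 + q ^ Suc j) / (1 - q ^ Suc j)))"
    by (rule prodinf_exp) (use ln_ratio_sums_lam[OF q] in \<open>auto simp: sums_iff\<close>)
  also have "(\<Sum>j. ln ((1 + q ^ Suc j) / (1 - q ^ Suc j))) = (\<Sum>k. lam k * q ^ k)"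
    using ln_ratio_sums_lam[OF q] by (simp add: sums_iff)
  finally show ?thesis .
qed

lemma cubic_gf_eq_exp:
  assumes q: "\<bar>q\<bar> < 1"
  shows "cubic_gf q = exp (\<Sum>k. lcf k * q ^ k)"
proof -
  have q2: "\<bar>q\<^sup>2\<bar> < 1" using q by (simp add: abs_square_less_1)
  have s1: "(\<lambda>k. lam k * q ^ k) sums (\<Sum>k. lam k * q ^ k)"
    using summable_norm_cancel[OF summable_lam[OF q]] by (rule summable_sums)
  have "(\<lambda>k. lam k * (q\<^sup>2) ^ k) sums (\<Sum>k. lam k * (q\<^sup>2) ^ k)"
    using summable_norm_cancel[OF summable_lam[OF q2]] by (rule summable_sums)
  then have s2: "(\<lambda>k. if even k then lam (k div 2) * q ^ k else 0) sums (\<Sum>k. lam k * (q\<^sup>2) ^ k)"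
    by (subst sums_mono_reindex[of "\<lambda>k. 2 * k", symmetric]) (auto simp: strict_mono_def power_mult)
  have "(\<lambda>k. lcf k * q ^ k) = (\<lambda>k. lam k * q ^ k + (if even k then lam (k div 2) * q ^ k else 0))"
    by (auto simp: lcf_def algebra_simps)
  then have "(\<lambda>k. lcf k * q ^ k) sums ((\<Sum>k. lam k * q ^ k) + (\<Sum>k. lam k * (q\<^sup>2) ^ k))"
    using sums_add[OF s1 s2] by simp
  then have "exp (\<Sum>k. lcf k * q ^ k) = exp (\<Sum>k. lam k * q ^ k) * exp (\<Sum>k. lam k * (q\<^sup>2) ^ k)"
    by (simp add: sums_iff exp_add)
  then show ?thesis
    by (simp add: cubic_gf_def qpoch_inf_ratio[OF q, symmetric] qpoch_inf_ratio[OF q2, symmetric])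
qed

section \<open>Coefficients as circle integrals\<close>

definition lfps :: "complex fps" where "lfps = Abs_fps (\<lambda>k. of_real (lcf k))"

definition gfun :: "complex \<Rightarrow> complex" where "gfun z = exp (eval_fps lfps z)"

definition acoef :: "nat \<Rightarrow> real" where "acoef n = Re (fps_nth (fps_expansion gfun 0) n)"

lemma lfps_conv_radius: "fps_conv_radius lfps \<ge> 1"
  unfolding fps_conv_radius_def
proof (rule conv_radius_geI_ex')
  fix r :: real assume "0 < r" "ereal r < 1"
  then have "summable (\<lambda>k. lcf k * real k ^ 0 * r ^ k)" by (intro summable_lcf_moment) auto
  then have "summable (\<lambda>k. complex_of_real (lcf k * r ^ k))" by (intro summable_of_real) simp
  then show "summable (\<lambda>n. fps_nth lfps n * of_real r ^ n)" by (simp add: lfps_def)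
qed

lemma lfps_conv_radius_gt:
  assumes "norm z < 1" shows "ereal (norm z) < fps_conv_radius lfps"
proof -
  have "ereal (norm z) < 1" using assms by simp
  then show ?thesis using lfps_conv_radius by (rule less_le_trans)
qed

lemma gfun_holomorphic: "gfun holomorphic_on eball 0 1"
proof -
  have "norm z < fps_conv_radius lfps" if "z \<in> eball 0 1" for z :: complex
    using that lfps_conv_radius_gt by auto
  then show ?thesis unfolding gfun_def by (intro holomorphic_intros) auto
qed

lemma gfun_has_fps_expansion: "gfun has_fps_expansion fps_expansion gfun 0"
  by (rule has_fps_expansion_fps_expansion[of "eball 0 1"]) (auto simp: gfun_holomorphic)

text \<open>The differential equation of the exponential. Its coefficients form a recurrence with
  nonnegative terms, which makes the coefficients of \<open>gfun\<close> real and nonnegative and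
  later yields the recurrence for the reciprocal series.\<close>

lemma gfun_fps_deriv: "fps_deriv (fps_expansion gfun 0) = fps_deriv lfps * fps_expansion gfun 0"
proof (rule fps_expansion_unique_complex)
  show "deriv gfun has_fps_expansion fps_deriv (fps_expansion gfun 0)"
    by (intro fps_expansion_intros gfun_has_fps_expansion)
  have pos: "fps_conv_radius lfps > 0" using lfps_conv_radius_gt[of 0] by (simp add: zero_ereal_def)
  have "(\<lambda>z. eval_fps (fps_deriv lfps) z * gfun z) has_fps_expansion fps_deriv lfps * fps_expansion gfun 0"
    by (intro has_fps_expansion_mult gfun_has_fps_expansion eval_fps_has_fps_expansion)
      (use pos fps_conv_radius_deriv[of lfps] in auto)
  moreover have "eventually (\<lambda>z::complex. z \<in> eball 0 1) (nhds 0)"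
    by (intro eventually_nhds_in_open) auto
  then have "eventually (\<lambda>z. eval_fps (fps_deriv lfps) z * gfun z = deriv gfun z) (nhds 0)"
  proof eventually_elim
    case (elim z)
    have "ereal (norm z) < fps_conv_radius lfps"
      using elim lfps_conv_radius_gt by auto
    then have "(gfun has_field_derivative eval_fps (fps_deriv lfps) z * gfun z) (at z)"
      unfolding gfun_def by (auto intro!: derivative_eq_intros)
    then show ?case by (simp add: DERIV_imp_deriv)
  qed
  ultimately show "deriv gfun has_fps_expansion fps_deriv lfps * fps_expansion gfun 0"
    by (subst has_fps_expansion_cong[OF _ refl]) (auto elim: eventually_mono)
qed

lemma gfun_coeff_rec:
  "of_nat (Suc n) * fps_nth (fps_expansion gfun 0) (Suc n) =
     (\<Sum>i\<le>n. of_real (real (Suc i) * lcf (Suc i)) * fps_nth (fps_expansion gfun 0) (n - i))"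
  using arg_cong[OF gfun_fps_deriv, of "\<lambda>f. fps_nth f n"]
  by (simp add: fps_mult_nth lfps_def atLeast0AtMost)

lemma gfun_coeff_0: "fps_nth (fps_expansion gfun 0) 0 = 1"
proof -
  have "fps_nth (fps_expansion gfun 0) 0 = gfun 0" by (simp add: fps_expansion_def)
  also have "\<dots> = 1" by (simp add: gfun_def eval_fps_at_0 lfps_def)
  finally show ?thesis .
qed

lemma gfun_coeff_nonneg_real: "fps_nth (fps_expansion gfun 0) n = of_real (acoef n) \<and> 0 \<le> acoef n"
proof (induction n rule: less_induct)
  case (less n)
  show ?case
  proof (cases n)
    case 0
    then show ?thesis by (simp add: acoef_def gfun_coeff_0)
  next
    case (Suc m)
    let ?s = "\<Sum>i\<le>m. real (Suc i) * lcf (Suc i) * acoef (m - i)"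
    have "of_nat (Suc m) * fps_nth (fps_expansion gfun 0) (Suc m) =
        (\<Sum>i\<le>m. of_real (real (Suc i) * lcf (Suc i)) * complex_of_real (acoef (m - i)))"
      unfolding gfun_coeff_rec using less by (intro sum.cong) (auto simp: Suc)
    also have "\<dots> = of_real ?s" by simp
    finally have eq: "fps_nth (fps_expansion gfun 0) (Suc m) = of_real (?s / real (Suc m))"
      by (simp add: field_simps del: of_nat_Suc)
    have "?s \<ge> 0" by (intro sum_nonneg mult_nonneg_nonneg lcf_nonneg) (use less Suc in auto)
    then show ?thesis using eq by (simp add: Suc acoef_def)
  qed
qed

lemma acoef_nonneg: "0 \<le> acoef n" using gfun_coeff_nonneg_real by simp

lemma acoef_0: "acoef 0 = 1" by (simp add: acoef_def gfun_coeff_0)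

lemma acoef_fps_deriv:
  "fps_deriv (Abs_fps acoef) = fps_deriv (Abs_fps lcf) * Abs_fps acoef"
proof (rule fps_ext)
  fix n
  have "complex_of_real (real (Suc n) * acoef (Suc n)) =
      of_real (\<Sum>i\<le>n. real (Suc i) * lcf (Suc i) * acoef (n - i))"
    using gfun_coeff_rec[of n] gfun_coeff_nonneg_real by simp
  then have "real (Suc n) * acoef (Suc n) = (\<Sum>i\<le>n. real (Suc i) * lcf (Suc i) * acoef (n - i))"
    unfolding of_real_eq_iff .
  then show "fps_nth (fps_deriv (Abs_fps acoef)) n = fps_nth (fps_deriv (Abs_fps lcf) * Abs_fps acoef) n"
    by (simp add: fps_mult_nth atLeast0AtMost)
qed

lemma eval_lfps: 
  assumes "norm z < 1"
  shows "(\<lambda>k. of_real (lcf k) * z ^ k) sums eval_fps lfps z"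
  using sums_eval_fps[OF lfps_conv_radius_gt[OF assms]] by (simp add: lfps_def)

lemma acoef_sums:
  fixes q :: real
  assumes "\<bar>q\<bar> < 1"
  shows "(\<lambda>n. acoef n * q ^ n) sums cubic_gf q"
proof -
  have n: "ereal (norm (of_real q :: complex)) < 1" using assms by simp
  have "ereal (norm (of_real q :: complex)) < fps_conv_radius (fps_expansion gfun 0)"
    using n conv_radius_fps_expansion[OF gfun_holomorphic] by (rule less_le_trans)
  from sums_eval_fps[OF this] eval_fps_expansion'[OF gfun_holomorphic n]
  have "(\<lambda>n. complex_of_real (acoef n) * of_real q ^ n) sums gfun (of_real q)"
    using gfun_coeff_nonneg_real by simp
  also have "gfun (of_real q) = of_real (cubic_gf q)"
  proof -
    have "summable (\<lambda>k. \<bar>lcf k * q ^ k\<bar>)"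
      using summable_lcf_moment[of "\<bar>q\<bar>" 0] assms lcf_nonneg by (simp add: abs_mult power_abs)
    then have "(\<lambda>k. lcf k * q ^ k) sums (\<Sum>k. lcf k * q ^ k)"
      by (intro summable_sums) (rule summable_rabs_cancel)
    then have "(\<lambda>k. complex_of_real (lcf k * q ^ k)) sums of_real (\<Sum>k. lcf k * q ^ k)"
      by (simp only: sums_of_real_iff)
    then have "eval_fps lfps (of_real q) = of_real (\<Sum>k. lcf k * q ^ k)"
      using eval_lfps[of "of_real q"] assms by (auto dest: sums_unique2)
    then show ?thesis by (simp add: gfun_def cubic_gf_eq_exp[OF assms] exp_of_real)
  qed
  finally show ?thesis unfolding of_real_power[symmetric] of_real_mult[symmetric] sums_of_real_iff .
qed

text \<open>The definite description needs uniqueness: once the coefficients below n agree, x^n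
  cancels from the difference of the two expansions, and letting x tend to 0 isolates coefficient
  n.\<close>

lemma cubic_overpartition_eq: "cubic_overpartition = acoef"
  unfolding cubic_overpartition_def
proof (rule the_equality)
  show "\<forall>q. \<bar>q\<bar> < 1 \<longrightarrow> (\<lambda>n. acoef n * q ^ n) sums cubic_gf q" using acoef_sums by blast
next
  fix a :: "nat \<Rightarrow> real"
  assume a: "\<forall>q. \<bar>q\<bar> < 1 \<longrightarrow> (\<lambda>n. a n * q ^ n) sums cubic_gf q"
  have "a n - acoef n = 0" for n
  proof (induction n rule: less_induct)
    case (less n)
    have "(\<lambda>k. (a (k + n) - acoef (k + n)) * x ^ k) sums 0" if x: "x \<noteq> 0" "norm x < 1" for x :: real
    proof -
      have "(\<lambda>k. a k * x ^ k - acoef k * x ^ k) sums (cubic_gf x - cubic_gf x)"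
        using a acoef_sums x by (intro sums_diff) auto
      then have "(\<lambda>k. (a k - acoef k) * x ^ k) sums 0" by (simp add: left_diff_distrib)
      then have "(\<lambda>k. (a (k + n) - acoef (k + n)) * x ^ (k + n)) sums 0"
        using sums_iff_shift[of "\<lambda>k. (a k - acoef k) * x ^ k" n 0] less by simp
      then have "(\<lambda>k. 1 / x ^ n * ((a (k + n) - acoef (k + n)) * x ^ (k + n))) sums (1 / x ^ n * 0)"
        by (rule sums_mult)
      moreover have "1 / x ^ n * ((a (k + n) - acoef (k + n)) * x ^ (k + n)) = (a (k + n) - acoef (k + n)) * x ^ k" for k
        using x by (simp add: power_add)
      ultimately show ?thesis by (simp only: mult_zero_right)
    qed
    from powser_limit_0_strong[OF zero_less_one this]
    have "((\<lambda>x::real. 0::real) \<longlongrightarrow> a n - acoef n) (at 0)" by simp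
    from tendsto_unique[OF _ this tendsto_const] show ?case by simp
  qed
  then show "a = acoef" by auto
qed

lemma gfun_coeff_integral:
  assumes r: "0 < r" "r < 1"
  shows "((\<lambda>x. gfun (of_real r * cis x) * cis (- (real n * x))) has_integral of_real (2 * pi * acoef n * r ^ n)) {0..2 * pi}"
proof -
  let ?I = "(2 * pi * \<i>) / (fact n) * (deriv ^^ n) gfun 0"
  have I: "?I = 2 * pi * \<i> * of_real (acoef n)"
  proof -
    have "(deriv ^^ n) gfun 0 / fact n = of_real (acoef n)"
      using gfun_coeff_nonneg_real[of n] by (simp add: fps_expansion_def)
    then show ?thesis by (simp add: field_simps)
  qed
  have sub: "cball 0 r \<subseteq> eball (0::complex) 1" using r by auto
  have h: "gfun holomorphic_on cball 0 r" using gfun_holomorphic sub by (rule holomorphic_on_subset)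
  have "((\<lambda>u. gfun u / (u - 0) ^ Suc n) has_contour_integral ?I) (circlepath 0 r)"
    by (rule Cauchy_has_contour_integral_higher_derivative_circlepath)
      (use h r in \<open>auto intro: holomorphic_on_imp_continuous_on holomorphic_on_subset\<close>)
  then have "((\<lambda>x. gfun (of_real r * cis x) / (of_real r * cis x) ^ Suc n * of_real r * \<i> * cis x) has_integral ?I) {0..2 * pi}"
    unfolding circlepath_def by (subst (asm) has_contour_integral_part_circlepath_iff) auto
  then have "((\<lambda>x. of_real r ^ n / \<i> * (gfun (of_real r * cis x) / (of_real r * cis x) ^ Suc n * of_real r * \<i> * cis x))
     has_integral of_real r ^ n / \<i> * ?I) {0..2 * pi}"
    by (rule has_integral_mult_right)
  moreover have "of_real r ^ n / \<i> * ?I = of_real (2 * pi * acoef n * r ^ n)"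
    unfolding I by (simp add: field_simps)
  moreover have "of_real r ^ n / \<i> * (gfun (of_real r * cis x) / (of_real r * cis x) ^ Suc n * of_real r * \<i> * cis x)
     = gfun (of_real r * cis x) * cis (- (real n * x))" for x
  proof -
    have "(cis x) ^ n = cis (real n * x)" by (rule Complex.DeMoivre)
    then show ?thesis using r by (simp add: power_mult_distrib cis_mult field_simps flip: cis_inverse)
  qed
  ultimately show ?thesis by simp
qed


section \<open>The integrand in real form\<close>

definition lcos :: "real \<Rightarrow> real \<Rightarrow> real" where "lcos r x = (\<Sum>k. lcf k * r ^ k * cos (real k * x))"

definition lsin :: "real \<Rightarrow> real \<Rightarrow> real" where "lsin r x = (\<Sum>k. lcf k * r ^ k * sin (real k * x))"

lemma eval_lfps_cis:
  assumes r: "0 \<le> r" "r < 1"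
  shows "eval_fps lfps (of_real r * cis x) = Complex (lcos r x) (lsin r x)"
proof -
  have "(\<lambda>k. of_real (lcf k) * (of_real r * cis x) ^ k) sums eval_fps lfps (of_real r * cis x)"
    by (rule eval_lfps) (use r in \<open>simp add: norm_mult\<close>)
  also have "(\<lambda>k. of_real (lcf k) * (of_real r * cis x) ^ k) =
      (\<lambda>k. Complex (lcf k * r ^ k * cos (real k * x)) (lcf k * r ^ k * sin (real k * x)))"
    by (rule ext) (simp add: power_mult_distrib Complex.DeMoivre complex_eq_iff flip: of_real_power)
  finally have "(\<lambda>k. lcf k * r ^ k * cos (real k * x)) sums Re (eval_fps lfps (of_real r * cis x))"
    "(\<lambda>k. lcf k * r ^ k * sin (real k * x)) sums Im (eval_fps lfps (of_real r * cis x))"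
    by (auto simp: sums_complex_iff)
  then show ?thesis by (simp add: lcos_def lsin_def sums_iff complex_eq_iff)
qed

text \<open>The factor 1 - cos x encodes the second difference in n: 2 e^(-inx) - e^(-i(n+1)x) -
  e^(-i(n-1)x) equals 2 e^(-inx) (1 - cos x).\<close>

definition kern :: "real \<Rightarrow> nat \<Rightarrow> real \<Rightarrow> real" where
  "kern r n x = exp (lcos r x) * cos (lsin r x - real n * x) * (1 - cos x)"

lemma kern_eq_Re:
  assumes "0 \<le> r" "r < 1"
  shows "kern r n x = Re (gfun (of_real r * cis x) * cis (- (real n * x))) * (1 - cos x)"
  unfolding gfun_def eval_lfps_cis[OF assms]
  by (simp add: kern_def exp_eq_polar cis_mult cos_diff cos_add algebra_simps)

lemma summable_lcf_bounded:
  assumes "0 \<le> r" "r < 1" "\<And>k. \<bar>f k\<bar> \<le> c * real k ^ j" "j \<le> 3"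
  shows "summable (\<lambda>k. lcf k * r ^ k * f k)"
proof (rule summable_comparison_test')
  show "summable (\<lambda>k. c * (lcf k * real k ^ j * r ^ k))"
    using assms by (intro summable_mult summable_lcf_moment)
  show "norm (lcf k * r ^ k * f k) \<le> c * (lcf k * real k ^ j * r ^ k)" for k
    using mult_left_mono[OF assms(3)[of k], of "lcf k * r ^ k"] assms(1) lcf_nonneg[of k]
    by (simp add: abs_mult mult_ac)
qed

text \<open>Reduces the circle to [0,pi], where cos is monotone; the later decay estimates rely on
  that. The reflection negates the phase up to n full turns, and cos is even.\<close>

lemma kern_reflect:
  assumes r: "0 \<le> r" "r < 1"
  shows "kern r n (2 * pi - x) = kern r n x"
proof -
  have "cos (real k * (2 * pi - x)) = cos (real k * x)" "sin (real k * (2 * pi - x)) = - sin (real k * x)" for k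
  proof -
    have "real k * (2 * pi - x) = real k * (2 * pi) + - (real k * x)" by (simp add: algebra_simps)
    then show "cos (real k * (2 * pi - x)) = cos (real k * x)" "sin (real k * (2 * pi - x)) = - sin (real k * x)"
      using cos_int_2pin[of "int k"] sin_int_2pin[of "int k"]
      by (simp_all only: cos_add sin_add) (simp_all add: mult_ac)
  qed
  note trig = this
  have 1: "lcos r (2 * pi - x) = lcos r x" by (simp add: lcos_def trig)
  have 2: "lsin r (2 * pi - x) - real n * (2 * pi - x) = - (lsin r x - real n * x) - real n * (2 * pi)"
  proof -
    have "lsin r (2 * pi - x) = - lsin r x" unfolding lsin_def trig mult_minus_right
      by (rule suminf_minus) (rule summable_lcf_bounded[OF r, of _ 1 0]; simp)
    then show ?thesis by (simp add: algebra_simps)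
  qed
  have 3: "cos (- (lsin r x - real n * x) - real n * (2 * pi)) = cos (lsin r x - real n * x)"
    using cos_int_2pin[of "int n"] sin_int_2pin[of "int n"] by (simp add: cos_diff mult_ac)
  show ?thesis unfolding kern_def 1 2 3 using trig(1)[of 1] by simp
qed

lemma kern_has_integral:
  assumes r: "0 < r" "r < 1" and n: "n \<ge> 1"
  shows "(kern r n has_integral pi / 2 * (2 * acoef n * r ^ n - acoef (n + 1) * r ^ (n + 1) - acoef (n - 1) * r ^ (n - 1))) {0..pi}"
proof -
  define D where "D = 2 * acoef n * r ^ n - acoef (n + 1) * r ^ (n + 1) - acoef (n - 1) * r ^ (n - 1)"
  let ?f = "\<lambda>n x. gfun (of_real r * cis x) * cis (- (real n * x))"
  have "((\<lambda>x. 1 / 2 * (2 * ?f n x - ?f (n + 1) x - ?f (n - 1) x)) has_integral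
     1 / 2 * (2 * of_real (2 * pi * acoef n * r ^ n) - of_real (2 * pi * acoef (n + 1) * r ^ (n + 1)) - of_real (2 * pi * acoef (n - 1) * r ^ (n - 1)))) {0..2 * pi}"
    by (intro has_integral_diff has_integral_mult_right gfun_coeff_integral r)
  then have "((\<lambda>x. 1 / 2 * (2 * ?f n x - ?f (n + 1) x - ?f (n - 1) x)) has_integral of_real (pi * D)) {0..2 * pi}"
    by (simp add: D_def algebra_simps)
  from has_integral_Re[OF this]
  have "((\<lambda>x. Re (1 / 2 * (2 * ?f n x - ?f (n + 1) x - ?f (n - 1) x))) has_integral pi * D) {0..2 * pi}"
    by simp
  also have "(\<lambda>x. Re (1 / 2 * (2 * ?f n x - ?f (n + 1) x - ?f (n - 1) x))) = kern r n"
  proof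
    fix x
    have c: "cis (- (real (n + 1) * x)) = cis (- (real n * x)) * cis (- x)"
      "cis (- (real (n - 1) * x)) = cis (- (real n * x)) * cis x"
      using n by (simp_all add: cis_mult algebra_simps of_nat_diff)
    have "1 / 2 * (2 * ?f n x - ?f (n + 1) x - ?f (n - 1) x) = ?f n x * (1 - (cis (- x) + cis x) / 2)"
      unfolding c by (simp add: algebra_simps)
    also have "1 - (cis (- x) + cis x) / 2 = of_real (1 - cos x)" by (simp add: complex_eq_iff)
    finally have eq: "1 / 2 * (2 * ?f n x - ?f (n + 1) x - ?f (n - 1) x) = ?f n x * of_real (1 - cos x)" .
    show "Re (1 / 2 * (2 * ?f n x - ?f (n + 1) x - ?f (n - 1) x)) = kern r n x"
      unfolding eq using r by (subst kern_eq_Re) auto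
  qed
  finally have I: "(kern r n has_integral pi * D) {0..2 * pi}" .
  then have "kern r n integrable_on {0..pi}" 
    using integrable_on_subinterval[of "kern r n" "{0..2 * pi}" 0 pi] by (auto simp: integrable_on_def)
  then obtain J where J: "(kern r n has_integral J) {0..pi}" by (auto simp: integrable_on_def)
  have "((\<lambda>x. kern r n (- 1 *\<^sub>R x + 2 * pi)) has_integral J) ((\<lambda>x. - x + 2 * pi) ` {0..pi})"
    using has_integral_affinity[of "kern r n" J 0 pi "- 1" "2 * pi"] J by simp
  moreover have "(\<lambda>x. - x + 2 * pi) ` {0..pi} = {pi..2 * pi}"
    by (auto simp: image_iff intro!: bexI[of _ "2 * pi - _"])
  moreover have "kern r n (- 1 *\<^sub>R x + 2 * pi) = kern r n x" for x
    using kern_reflect[of r n x] r by simp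
  ultimately have "(kern r n has_integral J) {pi..2 * pi}" by simp
  then have "(kern r n has_integral J + J) {0..2 * pi}" using J by (intro has_integral_combine[of 0 pi]) auto
  then have "J + J = pi * D" using I by (rule has_integral_unique)
  then have "J = pi / 2 * D" by simp
  then show ?thesis using J unfolding D_def by (simp only:)
qed

section \<open>Phase and decay on the circle\<close>

lemma one_minus_cos_le: "1 - cos (y::real) \<le> y\<^sup>2 / 2"
proof -
  have "1 - cos y = 2 * (sin (y / 2))\<^sup>2" using cos_double_sin[of "y / 2"] by simp
  also have "(sin (y / 2))\<^sup>2 \<le> (y / 2)\<^sup>2"
    using abs_sin_x_le_abs_x[of "y / 2"] by (simp only: abs_le_square_iff)
  finally show ?thesis by (simp add: power2_eq_square)
qed

lemma abs_sin_minus_le: "\<bar>sin (y::real) - y\<bar> \<le> \<bar>y\<bar> ^ 3 / 6"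
  using Maclaurin_sin_bound[of y 3] by (simp add: numeral_3_eq_3 sin_coeff_def field_simps)

text \<open>Square the cubic lower bound for sin (y/2) in 1 - cos y = 2 sin^2 (y/2). Squaring
  requires that bound to be nonnegative; otherwise y^2 >= 24 and the left-hand side is at most
  0.\<close>

lemma one_minus_cos_ge: "y\<^sup>2 / 2 - y ^ 4 / 24 \<le> 1 - cos (y::real)"
proof -
  have ge: "\<bar>y\<bar> - \<bar>y\<bar> ^ 3 / 24 \<le> 2 * \<bar>sin (y / 2)\<bar>"
    using abs_sin_minus_le[of "y / 2"] by (simp add: power_divide) argo
  show ?thesis
  proof (cases "\<bar>y\<bar> - \<bar>y\<bar> ^ 3 / 24 \<ge> 0")
    case True
    have "(\<bar>y\<bar> - \<bar>y\<bar> ^ 3 / 24)\<^sup>2 \<le> (2 * \<bar>sin (y / 2)\<bar>)\<^sup>2" using ge True by (rule power_mono)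
    also have "\<dots> = 4 * (sin (y / 2))\<^sup>2" by (simp add: power_mult_distrib)
    also have "(\<bar>y\<bar> - \<bar>y\<bar> ^ 3 / 24)\<^sup>2 = y\<^sup>2 - y ^ 4 / 12 + y ^ 6 / 576"
    proof -
      have "(a - a ^ 3 / 24)\<^sup>2 = a\<^sup>2 - a ^ 4 / 12 + a ^ 6 / 576" for a :: real
        by (simp add: field_simps eval_nat_numeral)
      from this[of "\<bar>y\<bar>"] show ?thesis by (simp add: power_even_abs)
    qed
    finally have "y\<^sup>2 - y ^ 4 / 12 + y ^ 6 / 576 \<le> 4 * (sin (y / 2))\<^sup>2" .
    moreover have "0 \<le> y ^ 6 / 576" by simp
    ultimately have "y\<^sup>2 - y ^ 4 / 12 \<le> 4 * (sin (y / 2))\<^sup>2" by linarith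
    then show ?thesis using cos_double_sin[of "y / 2"] by simp
  next
    case False
    have "24 \<le> y\<^sup>2"
    proof (rule ccontr)
      assume "\<not> 24 \<le> y\<^sup>2"
      then have "\<bar>y\<bar> * y\<^sup>2 \<le> \<bar>y\<bar> * 24" by (intro mult_left_mono) auto
      moreover have "\<bar>y\<bar> ^ 3 = \<bar>y\<bar> * y\<^sup>2" by (simp add: power3_eq_cube power2_eq_square)
      ultimately show False using False by simp
    qed
    have "y\<^sup>2 * 24 \<le> y\<^sup>2 * y\<^sup>2" using \<open>24 \<le> y\<^sup>2\<close> by (intro mult_left_mono) auto
    moreover have "y\<^sup>2 * y\<^sup>2 = y ^ 4" by (simp flip: power_add)
    ultimately have "y\<^sup>2 / 2 - y ^ 4 / 24 \<le> 0" using zero_le_power2[of y] by linarith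
    then show ?thesis using cos_le_one[of y] by linarith
  qed
qed

text \<open>The decay exponent R x of the overview, as a single series with nonnegative terms, so
  that it can be bounded termwise from both sides.\<close>

definition ldec :: "real \<Rightarrow> real \<Rightarrow> real" where "ldec r x = (\<Sum>k. lcf k * r ^ k * (1 - cos (real k * x)))"

lemma summable_lcf_cos: 
  assumes "0 \<le> r" "r < 1"
  shows "summable (\<lambda>k. lcf k * r ^ k * cos (real k * x))"
  using assms by (rule summable_lcf_bounded[of _ _ 1 0]) auto

lemma summable_lcf_one_minus_cos: 
  assumes "0 \<le> r" "r < 1"
  shows "summable (\<lambda>k. lcf k * r ^ k * (1 - cos (real k * x)))"
  using assms by (rule summable_lcf_bounded[of _ _ 2 0]) (auto simp: abs_le_iff intro: order_trans[OF cos_ge_minus_one])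

lemma lcos_eq:
  assumes "0 \<le> r" "r < 1"
  shows "lcos r x = lcos r 0 - ldec r x"
proof -
  have "lcos r 0 - lcos r x = ldec r x"
    unfolding lcos_def ldec_def
    by (subst suminf_diff[OF summable_lcf_cos[OF assms] summable_lcf_cos[OF assms]]) (simp add: right_diff_distrib)
  then show ?thesis by simp
qed

lemma ldec_le:
  assumes "t > 0"
  shows "ldec (exp (- t)) x \<le> 15 / 4 * x\<^sup>2 / t ^ 3"
proof -
  have r: "0 \<le> exp (- t)" "exp (- t) < 1" using assms by auto
  note s = summable_lcf_moment[OF r, of 2]
  have "ldec (exp (- t)) x \<le> (\<Sum>k. x\<^sup>2 / 2 * (lcf k * real k ^ 2 * exp (- t) ^ k))"
    unfolding ldec_def
  proof (rule suminf_le)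
    show "lcf k * exp (- t) ^ k * (1 - cos (real k * x)) \<le> x\<^sup>2 / 2 * (lcf k * (real k)\<^sup>2 * exp (- t) ^ k)" for k
      using mult_left_mono[OF one_minus_cos_le[of "real k * x"], of "lcf k * exp (- t) ^ k"] lcf_nonneg[of k]
      by (simp add: power_mult_distrib mult_ac)
  qed (use s r in \<open>auto intro!: summable_mult summable_lcf_one_minus_cos simp del: exp_less_one_iff\<close>)
  also have "\<dots> = x\<^sup>2 / 2 * (\<Sum>k. lcf k * real k ^ 2 * exp (- t) ^ k)" using s by (intro suminf_mult) auto
  also have "\<dots> \<le> x\<^sup>2 / 2 * (15 / 2 / t ^ 3)" by (intro mult_left_mono suminf_lcf_moment_le(2) assms) auto
  finally show ?thesis by simp
qed

text \<open>The saddle point equation absorbs n x into the series: each term becomes sin (k x) - k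
  x, of cubic size, and the third moment gives 105/4/6 = 35/8.\<close>

lemma phase_le:
  assumes "t > 0" and n: "(\<Sum>k. lcf k * real k * exp (- t) ^ k) = real n"
  shows "\<bar>lsin (exp (- t)) x - real n * x\<bar> \<le> 35 / 8 * \<bar>x\<bar> ^ 3 / t ^ 4"
proof -
  have r: "0 \<le> exp (- t)" "exp (- t) < 1" using assms by auto
  note s = summable_lcf_moment[OF r, of 3] summable_lcf_moment[OF r, of 1, simplified]
  have s1: "summable (\<lambda>k. lcf k * exp (- t) ^ k * sin (real k * x))"
    by (rule summable_lcf_bounded[OF r, of _ 1 0]) auto
  define f where "f = (\<lambda>k. lcf k * exp (- t) ^ k * (sin (real k * x) - real k * x))"
  have fb: "norm (f k) \<le> \<bar>x\<bar> ^ 3 / 6 * (lcf k * real k ^ 3 * exp (- t) ^ k)" for k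
    using mult_left_mono[OF abs_sin_minus_le[of "real k * x"], of "lcf k * exp (- t) ^ k"] lcf_nonneg[of k]
    by (simp add: f_def abs_mult power_mult_distrib mult_ac)
  have sf: "summable (\<lambda>k. norm (f k))"
    by (rule summable_comparison_test'[where g = "\<lambda>k. \<bar>x\<bar> ^ 3 / 6 * (lcf k * real k ^ 3 * exp (- t) ^ k)"])
      (use s fb in \<open>auto intro!: summable_mult\<close>)
  have "lsin (exp (- t)) x - real n * x = (\<Sum>k. lcf k * exp (- t) ^ k * sin (real k * x)) - (\<Sum>k. lcf k * real k * exp (- t) ^ k * x)"
    unfolding lsin_def n[symmetric] using s by (simp add: suminf_mult2)
  also have "\<dots> = (\<Sum>k. f k)"
    using s s1 by (subst suminf_diff) (auto intro!: summable_mult2 simp: f_def algebra_simps)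
  also have "\<bar>\<dots>\<bar> \<le> (\<Sum>k. norm (f k))" using summable_norm[OF sf] by simp
  also have "\<dots> \<le> (\<Sum>k. \<bar>x\<bar> ^ 3 / 6 * (lcf k * real k ^ 3 * exp (- t) ^ k))"
    using sf s fb by (intro suminf_le summable_mult) auto
  also have "\<dots> = \<bar>x\<bar> ^ 3 / 6 * (\<Sum>k. lcf k * real k ^ 3 * exp (- t) ^ k)" using s by (intro suminf_mult) auto
  also have "\<dots> \<le> \<bar>x\<bar> ^ 3 / 6 * (105 / 4 / t ^ 4)" by (intro mult_left_mono suminf_lcf_moment_le(3) assms) auto
  finally show ?thesis by simp
qed

section \<open>Lower bounds for the decay\<close>

text \<open>This is 1/(1 - r) minus the real part of 1/(1 - r e^(ix)). The fraction is divided by r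
  so that the denominator contains (1 - r)^2/r, which is close to t^2 for r = e^(-t).\<close>

lemma geometric_cos_deficit_sums:
  assumes "0 < r" "r < 1"
  shows "(\<lambda>k. r ^ k * (1 - cos (real k * x))) sums
     ((1 + r) / (1 - r) * (1 - cos x) / ((1 - r)\<^sup>2 / r + 2 * (1 - cos x)))"
proof -
  define d where "d = 1 - r"
  define c where "c = cos x"
  have d: "0 < d" "d < 1" "r = 1 - d" using assms by (auto simp: d_def)
  have c: "c \<le> 1" by (simp add: c_def)
  let ?z = "of_real r * cis x"
  have "norm ?z < 1" using assms by (simp add: norm_mult)
  then have "(\<lambda>k. ?z ^ k) sums (1 / (1 - ?z))" by (rule geometric_sums)
  then have "(\<lambda>k. Re (?z ^ k)) sums Re (1 / (1 - ?z))" by (rule sums_Re)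
  moreover have "Re (?z ^ k) = r ^ k * cos (real k * x)" for k
    by (simp add: power_mult_distrib Complex.DeMoivre flip: of_real_power)
  moreover have "Re (1 / (1 - ?z)) = (1 - r * c) / (d\<^sup>2 + 2 * r * (1 - c))"
  proof -
    have "(1 - r * cos x)\<^sup>2 + (r * sin x)\<^sup>2 = d\<^sup>2 + 2 * r * (1 - c)"
    proof -
      have "(r * sin x)\<^sup>2 = r\<^sup>2 * (1 - c\<^sup>2)" by (simp add: power_mult_distrib sin_squared_eq c_def)
      then show ?thesis by (simp add: d_def c_def power2_eq_square algebra_simps)
    qed
    then show ?thesis by (simp add: Re_divide c_def power2_eq_square)
  qed
  ultimately have "(\<lambda>k. r ^ k * cos (real k * x)) sums ((1 - r * c) / (d\<^sup>2 + 2 * r * (1 - c)))" by simp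
  moreover have "(\<lambda>k. r ^ k) sums (1 / d)" using geometric_sums[of r] assms by (simp add: d_def)
  ultimately have "(\<lambda>k. r ^ k - r ^ k * cos (real k * x)) sums (1 / d - (1 - r * c) / (d\<^sup>2 + 2 * r * (1 - c)))"
    by (intro sums_diff)
  moreover have "1 / d - (1 - r * c) / (d\<^sup>2 + 2 * r * (1 - c)) = (1 + r) / d * (1 - c) / (d\<^sup>2 / r + 2 * (1 - c))"
  proof -
    have p: "d\<^sup>2 + 2 * r * (1 - c) > 0" using d c assms by (intro add_pos_nonneg) auto
    have "d\<^sup>2 / r + 2 * (1 - c) = (d\<^sup>2 + 2 * r * (1 - c)) / r" using assms by (simp add: field_simps)
    then have "(1 + r) / d * (1 - c) / (d\<^sup>2 / r + 2 * (1 - c)) = (1 + r) * (1 - c) * r / (d * (d\<^sup>2 + 2 * r * (1 - c)))"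
      using d by (simp add: mult_ac)
    moreover have "1 / d - (1 - r * c) / (d\<^sup>2 + 2 * r * (1 - c)) = ((d\<^sup>2 + 2 * r * (1 - c)) - (1 - r * c) * d) / (d * (d\<^sup>2 + 2 * r * (1 - c)))"
      using p d by (simp add: diff_frac_eq mult_ac)
    moreover have "(d\<^sup>2 + 2 * r * (1 - c)) - (1 - r * c) * d = (1 + r) * (1 - c) * r"
      unfolding d(3) by (simp add: power2_eq_square algebra_simps)
    ultimately show ?thesis by simp
  qed
  ultimately show ?thesis by (simp add: d_def c_def algebra_simps)
qed


text \<open>This is tanh (t/2) <= t/2 without denominators.\<close>

lemma tanh_half_le:
  fixes t :: real
  assumes "t \<ge> 0"
  shows "2 * (1 - exp (- t)) \<le> t * (1 + exp (- t))"
proof -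
  define f where "f = (\<lambda>t::real. t * (1 + exp (- t)) - 2 * (1 - exp (- t)))"
  have "f 0 \<le> f t"
  proof (rule DERIV_nonneg_imp_nondecreasing[OF assms])
    fix x :: real assume "0 \<le> x" "x \<le> t"
    have "(f has_real_derivative (1 - exp (- x) * (1 + x))) (at x)"
      unfolding f_def by (auto intro!: derivative_eq_intros simp: algebra_simps)
    moreover have "exp (- x) * (1 + x) \<le> exp (- x) * exp x" by (intro mult_left_mono) auto
    then have "0 \<le> 1 - exp (- x) * (1 + x)" by (simp flip: exp_add)
    ultimately show "\<exists>y. (f has_real_derivative y) (at x) \<and> 0 \<le> y" by blast
  qed
  then show ?thesis by (simp add: f_def)
qed

lemma frac_shift_mono:
  fixes p :: real
  assumes "0 < p" "p \<le> q" "0 \<le> e" "e \<le> E"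
  shows "e / (q + e) \<le> E / (p + E)"
proof -
  have "e * p \<le> E * q" using assms by (intro mult_mono) auto
  then show ?thesis using assms by (simp add: divide_simps) (simp add: algebra_simps)
qed

text \<open>The fraction E/(P + E) grows with E and falls with P, so any \<open>e\<close> below 2 (1
  - cos x) may replace it. By \<open>tanh_half_le\<close>, the prefactor is at least 1/t and 4 P <=
  t^2 (P + 4); for t <= 1/5 the latter gives P <= (100/99) t^2. The range up to 1/5 permits the use
  at 2 t.\<close>

lemma geometric_cos_deficit_ge:
  assumes t: "0 < t" "t \<le> 1 / 5" and e: "0 \<le> e" "e \<le> 2 * (1 - cos x)"
  shows "1 / t * (e / (51 / 50 * t\<^sup>2 + e)) \<le> (\<Sum>k. exp (- t) ^ k * (1 - cos (real k * x)))"
proof -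
  define r where "r = exp (- t)"
  define E where "E = 2 * (1 - cos x)"
  define P where "P = (1 - r)\<^sup>2 / r"
  have r: "0 < r" "r < 1" using t by (auto simp: r_def)
  have E: "e \<le> E" "0 \<le> E" using e by (auto simp: E_def)
  have P0: "P > 0" using r by (simp add: P_def)
  have th: "2 * (1 - r) \<le> t * (1 + r)" using tanh_half_le[of t] t by (simp add: r_def)
  have P: "P \<le> 51 / 50 * t\<^sup>2"
  proof -
    have "(2 * (1 - r))\<^sup>2 \<le> (t * (1 + r))\<^sup>2" by (rule power_mono[OF th]) (use r in auto)
    also have "\<dots> = t\<^sup>2 * ((1 - r)\<^sup>2 + 4 * r)" by (simp add: power2_eq_square algebra_simps)
    finally have "4 * (P * r) \<le> t\<^sup>2 * (P * r + 4 * r)" using r by (simp add: P_def power_mult_distrib del: right_diff_distrib_numeral)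
    then have "r * (4 * P) \<le> r * (t\<^sup>2 * (P + 4))" by (simp add: algebra_simps)
    then have "4 * P \<le> t\<^sup>2 * (P + 4)" using r by simp
    moreover have "t\<^sup>2 * P \<le> (1 / 5)\<^sup>2 * P" using t P0 by (intro mult_right_mono power_mono) auto
    ultimately have "99 * P \<le> 100 * t\<^sup>2" by (simp add: algebra_simps power2_eq_square)
    then show ?thesis using zero_le_power2[of t] by linarith
  qed
  have "1 / t * (e / (51 / 50 * t\<^sup>2 + e)) \<le> 1 / t * (E / (P + E))"
    using t by (intro mult_left_mono frac_shift_mono) (use P P0 E e in auto)
  also have "\<dots> \<le> (1 + r) / (1 - r) / 2 * (E / (P + E))"
  proof (rule mult_right_mono)
    show "1 / t \<le> (1 + r) / (1 - r) / 2" using th t r by (simp add: field_simps)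
  qed (use E P0 in auto)
  also have "\<dots> = (\<Sum>k. exp (- t) ^ k * (1 - cos (real k * x)))"
  proof -
    have "(1 + r) / (1 - r) / 2 * (E / (P + E)) = (1 + r) / (1 - r) * (1 - cos x) / (P + 2 * (1 - cos x))"
    proof -
      have "a / d / 2 * (2 * b / Q) = a / d * b / Q" for a b d Q :: real by simp
      then show ?thesis unfolding E_def .
    qed
    then show ?thesis using geometric_cos_deficit_sums[OF r, of x] by (simp only: sums_iff P_def r_def)
  qed
  finally show ?thesis .
qed

lemma lcf_ge: "lcf k \<ge> (if k = 0 then 0 else if even k then 4 else 2)"
  using lam_ge_2[of k] lam_ge_2[of "k div 2"] by (auto simp: lcf_def elim!: evenE)

text \<open>Only the terms of the double series for the logarithm with m = 1, where m is the odd
  divisor in the definition of the coefficients, are kept.\<close>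
lemma ldec_ge:
  assumes t: "0 < t" "t \<le> 1 / 10" and e: "0 \<le> e" "e \<le> 2 * (1 - cos x)"
    and e': "0 \<le> e'" "e' \<le> 2 * (1 - cos (2 * x))"
  shows "2 / t * (e / (51 / 50 * t\<^sup>2 + e)) + 1 / t * (e' / (51 / 50 * (2 * t)\<^sup>2 + e')) \<le> ldec (exp (- t)) x"
proof -
  have r: "0 \<le> exp (- t)" "exp (- t) < 1" using t by auto
  let ?g = "\<lambda>k. exp (- t) ^ k * (1 - cos (real k * x))"
  let ?h = "\<lambda>k. exp (- (2 * t)) ^ k * (1 - cos (real k * (2 * x)))"
  have g: "?g sums suminf ?g" 
    using geometric_cos_deficit_sums[of "exp (- t)" x] t by (auto simp: sums_iff)
  have h: "?h sums suminf ?h" 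
    using geometric_cos_deficit_sums[of "exp (- (2 * t))" "2 * x"] t by (auto simp: sums_iff)
  have h': "(\<lambda>k. if even k then ?g k else 0) sums suminf ?h"
  proof -
    have "?h = (\<lambda>k. if even (2 * k) then ?g (2 * k) else 0)"
      by (rule ext) (simp add: exp_of_nat_mult[symmetric] mult_ac)
    then show ?thesis using h
      by (subst sums_mono_reindex[of "\<lambda>k. 2 * k", symmetric]) (auto simp: strict_mono_def)
  qed
  have s: "(\<lambda>k. 2 * ?g k + 2 * (if even k then ?g k else 0)) sums (2 * suminf ?g + 2 * suminf ?h)"
    by (intro sums_add sums_mult g h')
  have "2 / t * (e / (51 / 50 * t\<^sup>2 + e)) + 1 / t * (e' / (51 / 50 * (2 * t)\<^sup>2 + e')) =
     2 * (1 / t * (e / (51 / 50 * t\<^sup>2 + e))) + 2 * (1 / (2 * t) * (e' / (51 / 50 * (2 * t)\<^sup>2 + e')))" by simp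
  also have "\<dots> \<le> 2 * suminf ?g + 2 * suminf ?h"
    by (intro add_mono mult_left_mono geometric_cos_deficit_ge) (use t e e' in auto)
  also have "\<dots> = (\<Sum>k. 2 * ?g k + 2 * (if even k then ?g k else 0))" using s by (simp add: sums_iff)
  also have "\<dots> \<le> ldec (exp (- t)) x" unfolding ldec_def
  proof (rule suminf_le)
    fix k
    have "(if k = 0 then 0 else if even k then 4 else 2) * ?g k \<le> lcf k * ?g k"
      by (intro mult_right_mono lcf_ge) auto
    then show "2 * ?g k + 2 * (if even k then ?g k else 0) \<le> lcf k * exp (- t) ^ k * (1 - cos (real k * x))"
      by (auto simp: algebra_simps split: if_splits)
  qed (use s summable_lcf_one_minus_cos[OF r] in \<open>auto simp: sums_iff\<close>)
  finally show ?thesis .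
qed

text \<open>The constant is 1 - (3/10)^2/12, and 3/10 is the largest value of 3 t.\<close>

lemma two_one_minus_cos_ge:
  assumes "\<bar>y\<bar> \<le> 3 / 10"
  shows "397 / 400 * y\<^sup>2 \<le> 2 * (1 - cos (y::real))"
proof -
  have "y\<^sup>2 \<le> (3 / 10)\<^sup>2" using assms by (metis abs_ge_zero power2_abs power_mono)
  then have "y\<^sup>2 * y\<^sup>2 \<le> (3 / 10)\<^sup>2 * y\<^sup>2" by (intro mult_right_mono) auto
  then have "y ^ 4 \<le> 9 / 100 * y\<^sup>2" by (simp add: eval_nat_numeral)
  then show ?thesis using one_minus_cos_ge[of y] by simp
qed

text \<open>As 51/50 * 19/20 lies below 397/400, \<open>e\<close> can carry the factor 51/50, which
  then cancels. The fraction at 2 x and 2 t has both parts multiplied by 4, so the two contributions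
  combine to 3/t.\<close>

lemma ldec_ge_near:
  assumes t: "0 < t" "t \<le> 1 / 10" and x: "0 \<le> x" "x \<le> t"
  shows "3 / t * (19 / 20 * x\<^sup>2 / (t\<^sup>2 + 19 / 20 * x\<^sup>2)) \<le> ldec (exp (- t)) x"
proof -
  define e where "e = 51 / 50 * (19 / 20 * x\<^sup>2)"
  have e: "e \<le> 397 / 400 * x\<^sup>2" "0 \<le> e" by (auto simp: e_def)
  have "2 / t * (e / (51 / 50 * t\<^sup>2 + e)) + 1 / t * ((4 * e) / (51 / 50 * (2 * t)\<^sup>2 + 4 * e)) \<le> ldec (exp (- t)) x"
    by (rule ldec_ge) (use t x e two_one_minus_cos_ge[of x] two_one_minus_cos_ge[of "2 * x"] in \<open>auto simp: power_mult_distrib\<close>)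
  also have "(4 * e) / (51 / 50 * (2 * t)\<^sup>2 + 4 * e) = (4 * e) / (4 * (51 / 50 * t\<^sup>2 + e))"
    by (simp add: power_mult_distrib)
  also have "\<dots> = e / (51 / 50 * t\<^sup>2 + e)" by (rule mult_divide_mult_cancel_left) simp
  also have "e / (51 / 50 * t\<^sup>2 + e) = (51 / 50 * (19 / 20 * x\<^sup>2)) / (51 / 50 * (t\<^sup>2 + 19 / 20 * x\<^sup>2))"
    unfolding e_def by (simp add: distrib_left)
  also have "\<dots> = 19 / 20 * x\<^sup>2 / (t\<^sup>2 + 19 / 20 * x\<^sup>2)" by (rule mult_divide_mult_cancel_left) simp
  finally show ?thesis by (simp add: add_divide_distrib algebra_simps)
qed

text \<open>Both x and 2 x stay below pi, so monotonicity of cos reduces the estimate to x = t,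
  where each fraction is 19/39.\<close>

lemma ldec_ge_mid:
  assumes t: "0 < t" "t \<le> 1 / 10" and x: "t \<le> x" "x \<le> 3 * t"
  shows "73 / 50 / t \<le> ldec (exp (- t)) x"
proof -
  define e where "e = 51 / 50 * (19 / 20 * t\<^sup>2)"
  have e: "e \<le> 397 / 400 * t\<^sup>2" "0 \<le> e" by (auto simp: e_def)
  have pi: "2 * x \<le> pi" "x \<le> pi" using t x pi_gt3 by auto
  have c: "cos x \<le> cos t" "cos (2 * x) \<le> cos (2 * t)"
    using t x pi by (auto intro!: cos_monotone_0_pi_le)
  have "2 / t * (e / (51 / 50 * t\<^sup>2 + e)) + 1 / t * ((4 * e) / (51 / 50 * (2 * t)\<^sup>2 + 4 * e)) \<le> ldec (exp (- t)) x"
    by (rule ldec_ge) (use t x e c two_one_minus_cos_ge[of t] two_one_minus_cos_ge[of "2 * t"] in \<open>auto simp: power_mult_distrib\<close>)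
  also have "e / (51 / 50 * t\<^sup>2 + e) = 19 / 39" using t by (simp add: e_def field_simps)
  also have "(4 * e) / (51 / 50 * (2 * t)\<^sup>2 + 4 * e) = 19 / 39" using t by (simp add: e_def field_simps)
  finally have "57 / 39 / t \<le> ldec (exp (- t)) x" by simp
  moreover have "73 / 50 / t \<le> 57 / 39 / t" using t by (intro divide_right_mono) auto
  ultimately show ?thesis by linarith
qed

text \<open>Near x = pi the value cos (2 x) returns to 1, so the doubled angle is given up by taking
  \<open>e'\<close> = 0; the other term is estimated at x = 3 t.\<close>

lemma ldec_ge_far:
  assumes t: "0 < t" "t \<le> 1 / 10" and x: "3 * t \<le> x" "x \<le> pi"
  shows "179 / 100 / t \<le> ldec (exp (- t)) x"
proof -
  define e where "e = 397 / 400 * (3 * t)\<^sup>2"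
  have c: "cos x \<le> cos (3 * t)" using t x by (auto intro!: cos_monotone_0_pi_le)
  have "2 / t * (e / (51 / 50 * t\<^sup>2 + e)) + 1 / t * (0 / (51 / 50 * (2 * t)\<^sup>2 + 0)) \<le> ldec (exp (- t)) x"
    by (rule ldec_ge) (use t x c two_one_minus_cos_ge[of "3 * t"] in \<open>auto simp: e_def\<close>)
  also have "e / (51 / 50 * t\<^sup>2 + e) = 3573 / 3981" using t by (simp add: e_def field_simps power_mult_distrib)
  finally have "7146 / 3981 / t \<le> ldec (exp (- t)) x" by simp
  moreover have "179 / 100 / t \<le> 7146 / 3981 / t" using t by (intro divide_right_mono) auto
  ultimately show ?thesis by linarith
qed

section \<open>Local concavity at the saddle point\<close>

lemma sum_le_exp:
  fixes x :: real
  assumes "0 \<le> x"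
  shows "(\<Sum>k<N. x ^ k / fact k) \<le> exp x"
proof -
  have "(\<Sum>k<N. x ^ k /\<^sub>R fact k) \<le> (\<Sum>k. x ^ k /\<^sub>R fact k)"
    by (rule sum_le_suminf) (use assms summable_exp_generic[of x] in auto)
  then show ?thesis by (simp add: exp_def field_simps)
qed

text \<open>With y = x/\<open>\<tau>\<close>, the first factor minorizes exp (-15/4 y^2) by 1 - u <=
  e^(-u) at u = 5/8 y^2, raised to the sixth power; the second minorizes the cosine of the phase. A
  polynomial minorant can be integrated exactly.\<close>

lemma lower_polynomial_has_integral:
  fixes \<tau> :: real
  assumes "\<tau> > 0"
  shows "((\<lambda>x. x\<^sup>2 * ((1 - 5 / 8 * (x / \<tau>)\<^sup>2) ^ 6 * (1 - 24 / 25 * (x / \<tau>) ^ 6))) has_integral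
    824486776357 / 19070366515200 * \<tau> ^ 3) {0..\<tau>}"
proof -
  \<comment> \<open>The coefficients of (1 - 5/8 z)^6 (1 - 24/25 z^3) in z =
    (x/\<open>\<tau>\<close>)^2.\<close>
  define c :: "real list" where "c = [1, - 15 / 4, 375 / 64, - 18697 / 3200, 120603 / 20480, - 101535 / 16384,
    1244425 / 262144, - 1125 / 512, 1125 / 2048, - 1875 / 32768]"
  have mono: "((\<lambda>x. x\<^sup>2 * (x / \<tau>) ^ m) has_integral \<tau> ^ 3 / real (m + 3)) {0..\<tau>}" for m
  proof -
    have "((\<lambda>x. x\<^sup>2 * (x / \<tau>) ^ m) has_integral (\<tau> ^ 3 / real (m + 3) * (\<tau> / \<tau>) ^ (m + 3) - \<tau> ^ 3 / real (m + 3) * (0 / \<tau>) ^ (m + 3))) {0..\<tau>}"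
    proof (rule fundamental_theorem_of_calculus)
      fix x assume "x \<in> {0..\<tau>}"
      have "((\<lambda>x. \<tau> ^ 3 / real (m + 3) * (x / \<tau>) ^ (m + 3)) has_real_derivative
          \<tau> ^ 3 / real (m + 3) * (real (m + 3) * (x / \<tau>) ^ (m + 3 - 1) * (1 / \<tau>))) (at x within {0..\<tau>})"
        by (intro derivative_eq_intros) (use assms in \<open>auto simp: power3_eq_cube\<close>)
      also have "\<tau> ^ 3 / real (m + 3) * (real (m + 3) * (x / \<tau>) ^ (m + 3 - 1) * (1 / \<tau>)) = x\<^sup>2 * (x / \<tau>) ^ m"
      proof -
        have "\<tau> ^ 3 / c * (c * (u * (x / \<tau>)\<^sup>2) * (1 / \<tau>)) = x\<^sup>2 * u" if "c \<noteq> 0" for c u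
          using that assms by (simp add: field_simps eval_nat_numeral)
        moreover have "m + 3 - 1 = m + 2" by simp
        ultimately show ?thesis by (simp only: power_add)
      qed
      finally show "((\<lambda>x. \<tau> ^ 3 / real (m + 3) * (x / \<tau>) ^ (m + 3)) has_vector_derivative x\<^sup>2 * (x / \<tau>) ^ m) (at x within {0..\<tau>})"
        by (simp add: has_real_derivative_iff_has_vector_derivative)
    qed (use assms in auto)
    then show ?thesis using assms by (simp add: power_0_left)
  qed
  have "((\<lambda>x. \<Sum>j<10. c ! j * (x\<^sup>2 * (x / \<tau>) ^ (2 * j))) has_integral (\<Sum>j<10. c ! j * (\<tau> ^ 3 / real (2 * j + 3)))) {0..\<tau>}"
    by (intro has_integral_sum has_integral_mult_right mono) auto
  also have "(\<Sum>j<10. c ! j * (\<tau> ^ 3 / real (2 * j + 3))) = 824486776357 / 19070366515200 * \<tau> ^ 3"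
    by (simp add: c_def lessThan_nat_numeral lessThan_Suc nth_Cons_numeral field_simps)
  also have "(\<lambda>x. \<Sum>j<10. c ! j * (x\<^sup>2 * (x / \<tau>) ^ (2 * j))) =
      (\<lambda>x. x\<^sup>2 * ((1 - 5 / 8 * (x / \<tau>)\<^sup>2) ^ 6 * (1 - 24 / 25 * (x / \<tau>) ^ 6)))"
  proof
    fix x
    define z where "z = (x / \<tau>)\<^sup>2"
    have "(1 - 5 / 8 * z) ^ 6 * (1 - 24 / 25 * z ^ 3) = (\<Sum>j<10. c ! j * z ^ j)"
    proof -
      \<comment> \<open>In w both factors have integer coefficients, 25 and 61440.\<close>
      define w where "w = z / 40"
      have "z = 40 * w" by (simp add: w_def)
      then show ?thesis
        by (simp add: c_def lessThan_nat_numeral lessThan_Suc nth_Cons_numeral eval_nat_numeral algebra_simps)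
    qed
    moreover have "(x / \<tau>) ^ (2 * j) = z ^ j" for j by (simp add: z_def power_mult)
    moreover have "(x / \<tau>) ^ 6 = z ^ 3" by (simp add: z_def flip: power_mult)
    ultimately show "(\<Sum>j<10. c ! j * (x\<^sup>2 * (x / \<tau>) ^ (2 * j))) =
        x\<^sup>2 * ((1 - 5 / 8 * (x / \<tau>)\<^sup>2) ^ 6 * (1 - 24 / 25 * (x / \<tau>) ^ 6))"
      by (simp add: sum_distrib_left mult_ac flip: z_def)
  qed
  finally show ?thesis .
qed

text \<open>The exponent is the linear minorant of the decay from \<open>tail_exponent_ge\<close>,
  which makes an explicit antiderivative \<open>H\<close> available. As \<open>H b\<close> is at
  most 0, the bound is independent of \<open>b\<close>.\<close>

lemma tail_integral:
  fixes \<tau> b :: real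
  assumes "\<tau> > 0" "\<tau> \<le> b"
  shows "\<exists>I. ((\<lambda>x. x\<^sup>2 / 2 * exp (121 / 50 - 5 * (x / \<tau>))) has_integral I) {\<tau>..b} \<and> I \<le> 37 / 250 * \<tau> ^ 3 * exp (- 129 / 50)"
proof -
  define H where "H x = - (\<tau> ^ 3 / 2) * (((x / \<tau>)\<^sup>2 / 5 + 2 * (x / \<tau>) / 25 + 2 / 125) * exp (121 / 50 - 5 * (x / \<tau>)))" for x
  have "((\<lambda>x. x\<^sup>2 / 2 * exp (121 / 50 - 5 * (x / \<tau>))) has_integral (H b - H \<tau>)) {\<tau>..b}"
  proof (rule fundamental_theorem_of_calculus)
    fix x assume "x \<in> {\<tau>..b}"
    have "(H has_real_derivative (x\<^sup>2 / 2 * exp (121 / 50 - 5 * (x / \<tau>)))) (at x within {\<tau>..b})"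
      unfolding H_def using assms
      by (auto intro!: derivative_eq_intros simp: field_simps eval_nat_numeral)
    then show "(H has_vector_derivative (x\<^sup>2 / 2 * exp (121 / 50 - 5 * (x / \<tau>)))) (at x within {\<tau>..b})"
      by (simp add: has_real_derivative_iff_has_vector_derivative)
  qed (use assms in auto)
  moreover have "H b \<le> 0" using assms unfolding H_def by (intro mult_nonpos_nonneg) auto
  moreover have "H \<tau> = - (37 / 250 * \<tau> ^ 3 * exp (- 129 / 50))" using assms by (simp add: H_def)
  ultimately show ?thesis by (intro exI[of _ "H b - H \<tau>"]) auto
qed

text \<open>For t = 1/10 the line nearly touches the right-hand side at y = 677/625, whence the square in the proof.\<close>

lemma tail_exponent_ge:
  fixes t y :: real
  assumes "0 < t" "t \<le> 1 / 10" "1 \<le> y" "t * y\<^sup>2 \<le> 1"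
  shows "5 * y - 121 / 50 \<le> 3 * (19 / 20 * y\<^sup>2 / (1 + 19 / 20 * (t * y\<^sup>2)))"
proof -
  have pos: "1 + 19 / 20 * (t * y\<^sup>2) > 0" using assms by (simp add: add_pos_nonneg)
  have l: "0 \<le> 5 * y - 121 / 50" using assms by simp
  have "(5 * y - 121 / 50) * (1 + 19 / 20 * (t * y\<^sup>2)) \<le> 57 / 20 * y\<^sup>2"
  \<comment> \<open>79/25 approximates the square root of 10, where the two available bounds y^2/10
    and 1 for t y^2 cross.\<close>
  proof (cases "y \<le> 79 / 25")
    case True
    have "t * y\<^sup>2 \<le> 1 / 10 * y\<^sup>2" using assms by (intro mult_right_mono) auto
    then have "(5 * y - 121 / 50) * (1 + 19 / 20 * (t * y\<^sup>2)) \<le> (5 * y - 121 / 50) * (1 + 19 / 20 * (1 / 10 * y\<^sup>2))"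
      using l by (intro mult_left_mono) auto
    also have "\<dots> \<le> 57 / 20 * y\<^sup>2"
    proof -
      define a :: real where "a = 677 / 625"
      \<comment> \<open>Division of the cubic by (y - a)^2: \<open>c\<close> makes the quadratic
        terms agree, and the linear remainder has nonnegative coefficients.\<close>
      define c :: real where "c = 30799 / 10000 - 19 / 20 * a"
      have "57 / 20 * y\<^sup>2 - (5 * y - 121 / 50) * (1 + 19 / 20 * (1 / 10 * y\<^sup>2)) =
         (y - a)\<^sup>2 * (c - 19 / 40 * y) + (2 * a * c + 19 / 40 * a\<^sup>2 - 5) * y + (121 / 50 - a\<^sup>2 * c)"
        by (simp add: c_def field_simps eval_nat_numeral)
      moreover have "0 \<le> (y - a)\<^sup>2 * (c - 19 / 40 * y)"
        using True by (intro mult_nonneg_nonneg) (auto simp: a_def c_def)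
      moreover have "0 \<le> (2 * a * c + 19 / 40 * a\<^sup>2 - 5) * y"
        using assms by (intro mult_nonneg_nonneg) (auto simp: a_def c_def power2_eq_square)
      moreover have "0 \<le> 121 / 50 - a\<^sup>2 * c" by (simp add: a_def c_def power2_eq_square)
      ultimately show ?thesis by linarith
    qed
    finally show ?thesis .
  next
    case False
    have "(5 * y - 121 / 50) * (1 + 19 / 20 * (t * y\<^sup>2)) \<le> (5 * y - 121 / 50) * (1 + 19 / 20 * 1)"
      using l assms by (intro mult_left_mono) auto
    also have "\<dots> \<le> 57 / 20 * y\<^sup>2"
    proof -
      have "57 / 20 * y\<^sup>2 - (5 * y - 121 / 50) * (1 + 19 / 20 * 1) =
          57 / 20 * (y - 79 / 25)\<^sup>2 + 8262 / 1000 * y + (4719 / 1000 - 57 / 20 * (79 / 25)\<^sup>2)"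
        by (simp add: field_simps power2_eq_square)
      moreover have "0 \<le> 57 / 20 * (y - 79 / 25)\<^sup>2" by simp
      moreover have "0 \<le> 8262 / 1000 * y + (4719 / 1000 - 57 / 20 * (79 / 25 :: real)\<^sup>2)"
        using False by (simp add: power2_eq_square)
      ultimately show ?thesis by linarith
    qed
    finally show ?thesis .
  qed
  then have "5 * y - 121 / 50 \<le> 57 / 20 * y\<^sup>2 / (1 + 19 / 20 * (t * y\<^sup>2))"
    unfolding pos_le_divide_eq[OF pos] .
  then show ?thesis by simp
qed

text \<open>A power of q = 1/t is absorbed by q/10 <= exp (q/10 - 1), sharp at t = 1/10; the
  exponential left over is largest there. The powers of t bring both losses to order t^5: the arc
  from t to 3 t already supplies t^3, the arc up to pi supplies none.\<close>

lemma exp_neg_inverse_bounds: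
  fixes t :: real
  assumes "0 < t" "t \<le> 1 / 10"
  shows "exp (- (73 / 50 / t)) \<le> 1 / 10000 * t\<^sup>2"
    and "exp (- (179 / 100 / t)) \<le> 1 / 500 * t ^ 5"
proof -
  define q where "q = 1 / t"
  have q: "q \<ge> 10" using assms by (simp add: q_def field_simps)
  have e: "q / 10 \<le> exp (q / 10 - 1)" using exp_ge_add_one_self[of "q / 10 - 1"] by simp
  have e1: "27 / 10 \<le> exp (1::real)"
    using sum_le_exp[of 1 6] by (simp add: lessThan_nat_numeral lessThan_Suc fact_numeral)
  have e2: "59 / 10 \<le> exp (179 / 100 :: real)"
    using sum_le_exp[of "179 / 100" 9] by (simp add: lessThan_nat_numeral lessThan_Suc fact_numeral power_divide)
  have "(q / 10)\<^sup>2 \<le> exp (q / 10 - 1) ^ 2" using e q by (intro power_mono) auto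
  also have "\<dots> = exp (q / 5 - 2)" by (simp flip: exp_of_nat_mult)
  finally have "exp (- (73 / 50 * q)) * (q / 10)\<^sup>2 \<le> exp (- (73 / 50 * q)) * exp (q / 5 - 2)"
    by (intro mult_left_mono) auto
  also have "\<dots> = exp (- (63 / 50 * q) - 2)" by (simp flip: exp_add)
  also have "\<dots> \<le> exp (- 14)" using q by simp
  also have "\<dots> = 1 / exp 1 ^ 14" by (simp add: exp_minus field_simps flip: exp_of_nat_mult)
  also have "\<dots> \<le> 1 / (27 / 10) ^ 14" by (intro divide_left_mono power_mono e1) auto
  also have "\<dots> \<le> 1 / 1000000" by (simp add: power_divide)
  finally have "exp (- (73 / 50 * q)) * q\<^sup>2 \<le> 1 / 10000" by (simp add: power_divide mult_ac)
  then show "exp (- (73 / 50 / t)) \<le> 1 / 10000 * t\<^sup>2" using assms by (simp add: q_def field_simps)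
  have "(q / 10) ^ 5 \<le> exp (q / 10 - 1) ^ 5" using e q by (intro power_mono) auto
  also have "\<dots> = exp (q / 2 - 5)" by (simp flip: exp_of_nat_mult)
  finally have "exp (- (179 / 100 * q)) * (q / 10) ^ 5 \<le> exp (- (179 / 100 * q)) * exp (q / 2 - 5)"
    by (intro mult_left_mono) auto
  also have "\<dots> = exp (- (129 / 100 * q) - 5)" by (simp flip: exp_add)
  also have "\<dots> \<le> exp (- 179 / 10)" using q by simp
  also have "\<dots> = 1 / exp (179 / 100) ^ 10" by (simp add: exp_minus field_simps flip: exp_of_nat_mult)
  also have "\<dots> \<le> 1 / (59 / 10) ^ 10" by (intro divide_left_mono power_mono e2) auto
  also have "\<dots> \<le> 1 / 50000000" by (simp add: power_divide)
  finally have "exp (- (179 / 100 * q)) * q ^ 5 \<le> 1 / 500" by (simp add: power_divide mult_ac)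
  then show "exp (- (179 / 100 / t)) \<le> 1 / 500 * t ^ 5" using assms by (simp add: q_def field_simps)
qed


text \<open>The interval [0,pi] is cut at \<open>\<tau>\<close> = t^(3/2), t and 3 t. Only the first
  piece is bounded below by a positive number; on the others the cosine of the phase is replaced by
  -1 and the decay alone must make the loss small against \<open>\<tau>\<close>^3.\<close>

lemma tilted_concavity:
  assumes t: "0 < t" "t \<le> 1 / 10" and n: "(\<Sum>k. lcf k * real k * exp (- t) ^ k) = real n" "n \<ge> 1"
  defines "r \<equiv> exp (- t)"
  shows "acoef (n + 1) * r ^ (n + 1) + acoef (n - 1) * r ^ (n - 1) < 2 * acoef n * r ^ n"
proof -
  define D where "D = 2 * acoef n * r ^ n - acoef (n + 1) * r ^ (n + 1) - acoef (n - 1) * r ^ (n - 1)"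
  define M where "M = exp (lcos r 0)"
  define \<eta> where "\<eta> x = lsin r x - real n * x" for x
  define K where "K x = exp (- ldec r x) * (cos (\<eta> x) * (1 - cos x))" for x
  define s where "s = sqrt t"
  define \<tau> where "\<tau> = t * s"
  have r: "0 < r" "r < 1" using t by (auto simp: r_def)
  have s: "0 < s" "s\<^sup>2 = t" using t by (auto simp: s_def)
  \<comment> \<open>The square root of 1/10, rounded up.\<close>
  have s_le: "s \<le> 317 / 1000" 
  proof (rule power2_le_imp_le)
    show "s\<^sup>2 \<le> (317 / 1000)\<^sup>2" using s t by (simp add: power2_eq_square)
  qed simp
  have t_le_s: "t \<le> s"
  proof -
    have "s * s \<le> s * 1" using s s_le by (intro mult_left_mono) auto
    moreover have "s * s = t" using s by (simp add: power2_eq_square)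
    ultimately show ?thesis by linarith
  qed
  have \<tau>: "0 < \<tau>" "\<tau>\<^sup>2 = t ^ 3" "\<tau> \<le> t" "\<tau> \<le> 317 / 10000"
  proof -
    show "0 < \<tau>" using t s by (simp add: \<tau>_def)
    show "\<tau>\<^sup>2 = t ^ 3" using s by (simp add: \<tau>_def power_mult_distrib eval_nat_numeral)
    show "\<tau> \<le> t" using t s s_le by (simp add: \<tau>_def mult_left_le)
    have "t * s \<le> 1 / 10 * (317 / 1000)" using t s s_le by (intro mult_mono) auto
    then show "\<tau> \<le> 317 / 10000" by (simp add: \<tau>_def)
  qed
  have K: "kern r n x = M * K x" for x
    by (simp add: kern_def K_def M_def \<eta>_def lcos_eq[OF less_imp_le[OF r(1)] r(2), of x] exp_diff exp_minus field_simps)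
  have "((\<lambda>x. kern r n x / M) has_integral pi / 2 * D / M) {0..pi}"
    unfolding D_def by (intro has_integral_divide kern_has_integral r n)
  then have intD: "(K has_integral pi / 2 * D / M) {0..pi}" by (simp add: K M_def)
  then have int: "K integrable_on {0..pi}" by (auto simp: integrable_on_def)
  have sub: "K integrable_on {a..b}" if "0 \<le> a" "b \<le> pi" for a b
    by (rule integrable_on_subinterval[OF int]) (use that in auto)
  have pi3: "3 * t \<le> pi" "t \<le> pi" using t pi_gt3 by auto

  have cosnn: "0 \<le> 1 - cos x" for x :: real by simp
  have K_ge: "- (E * (1 - cos x)) \<le> K x" if "exp (- ldec r x) \<le> E" for x E
  proof -
    have "- 1 * (exp (- ldec r x) * (1 - cos x)) \<le> cos (\<eta> x) * (exp (- ldec r x) * (1 - cos x))"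
      by (intro mult_right_mono mult_nonneg_nonneg) auto
    moreover have "exp (- ldec r x) * (1 - cos x) \<le> E * (1 - cos x)" using that by (intro mult_right_mono) auto
    ultimately show ?thesis by (simp add: K_def mult_ac)
  qed

  txt \<open>For x = \<open>\<tau>\<close> y the exponent is at most (15/4) y^2 and the phase at most (35/8) s y^3.\<close>

  have p1: "397 / 800 * (824486776357 / 19070366515200 * \<tau> ^ 3) \<le> integral {0..\<tau>} K"
  proof (rule has_integral_le)
    show "((\<lambda>x. 397 / 800 * (x\<^sup>2 * ((1 - 5 / 8 * (x / \<tau>)\<^sup>2) ^ 6 * (1 - 24 / 25 * (x / \<tau>) ^ 6))))
        has_integral 397 / 800 * (824486776357 / 19070366515200 * \<tau> ^ 3)) {0..\<tau>}"
      by (intro has_integral_mult_right lower_polynomial_has_integral \<tau>)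
    show "(K has_integral integral {0..\<tau>} K) {0..\<tau>}"
      using sub[of 0 \<tau>] \<tau> pi3 by (auto simp: has_integral_integral)
    fix x assume x: "x \<in> {0..\<tau>}"
    define y where "y = x / \<tau>"
    have y: "0 \<le> y" "y \<le> 1" "x = \<tau> * y" using x \<tau> by (auto simp: y_def)
    have y2: "0 \<le> y\<^sup>2" "y\<^sup>2 \<le> 1" "0 \<le> y ^ 6" "y ^ 6 \<le> 1" using y by (auto simp: power_le_one)
    have 1: "(1 - 5 / 8 * y\<^sup>2) ^ 6 \<le> exp (- ldec r x)"
    proof -
      have "(1 - 5 / 8 * y\<^sup>2) ^ 6 \<le> exp (- (5 / 8 * y\<^sup>2)) ^ 6"
        using exp_ge_add_one_self[of "- (5 / 8 * y\<^sup>2)"] y2 by (intro power_mono) auto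
      also have "\<dots> = exp (- (15 / 4 * y\<^sup>2))" by (simp flip: exp_of_nat_mult)
      also have "15 / 4 * y\<^sup>2 = 15 / 4 * x\<^sup>2 / t ^ 3"
        using t by (simp add: y(3) power_mult_distrib \<tau>)
      also have "exp (- (15 / 4 * x\<^sup>2 / t ^ 3)) \<le> exp (- ldec r x)"
        using ldec_le[OF t(1), of x] by (simp add: r_def)
      finally show ?thesis .
    qed
    have 2: "1 - 24 / 25 * y ^ 6 \<le> cos (\<eta> x)"
    proof -
      have "\<bar>\<eta> x\<bar> \<le> 35 / 8 * x ^ 3 / t ^ 4"
        using phase_le[OF t(1) n(1), of x] x by (simp add: \<eta>_def r_def)
      also have "x ^ 3 = t ^ 4 * (s * y ^ 3)"
        using s by (simp add: y(3) \<tau>_def power_mult_distrib eval_nat_numeral mult_ac)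
      also have "35 / 8 * (t ^ 4 * (s * y ^ 3)) / t ^ 4 = 35 / 8 * (s * y ^ 3)" using t by simp
      finally have "\<bar>\<eta> x\<bar>\<^sup>2 \<le> (35 / 8 * (s * y ^ 3))\<^sup>2" by (intro power_mono) auto
      also have "\<dots> = (35 / 8)\<^sup>2 * (t * y ^ 6)"
      proof -
        have "(y ^ 3)\<^sup>2 = y ^ 6" by (simp flip: power_mult)
        then show ?thesis by (simp only: power_mult_distrib s(2))
      qed
      also have "\<dots> \<le> (35 / 8)\<^sup>2 * (1 / 10 * y ^ 6)" using t y2 by (intro mult_left_mono mult_right_mono) auto
      also have "\<dots> = 245 / 128 * y ^ 6" by (simp add: power2_eq_square)
      finally have "(\<eta> x)\<^sup>2 \<le> 245 / 128 * y ^ 6" by simp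
      \<comment> \<open>As 245/256 < 24/25 < 1, the resulting bound for the cosine is positive up to
        y = 1, which the product estimate below needs.\<close>
      then have "(\<eta> x)\<^sup>2 / 2 \<le> 24 / 25 * y ^ 6" using y2(3) by linarith
      then show ?thesis using one_minus_cos_le[of "\<eta> x"] by linarith
    qed
    have 3: "397 / 800 * x\<^sup>2 \<le> 1 - cos x"
      using two_one_minus_cos_ge[of x] x \<tau> by auto
    have "(1 - 5 / 8 * y\<^sup>2) ^ 6 * ((1 - 24 / 25 * y ^ 6) * (397 / 800 * x\<^sup>2)) \<le> K x"
      unfolding K_def using y2 1 2 3
      by (intro mult_mono) (auto intro!: mult_nonneg_nonneg intro: order_trans[of 0 "1 - 24 / 25 * y ^ 6"])
    then show "397 / 800 * (x\<^sup>2 * ((1 - 5 / 8 * (x / \<tau>)\<^sup>2) ^ 6 * (1 - 24 / 25 * (x / \<tau>) ^ 6))) \<le> K x"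
      by (simp only: y_def mult_ac)
  qed

  have p2: "- (37 / 250 * \<tau> ^ 3 * exp (- 129 / 50)) \<le> integral {\<tau>..t} K"
  proof -
    obtain I where I: "((\<lambda>x. x\<^sup>2 / 2 * exp (121 / 50 - 5 * (x / \<tau>))) has_integral I) {\<tau>..t}"
      "I \<le> 37 / 250 * \<tau> ^ 3 * exp (- 129 / 50)" using tail_integral[OF \<tau>(1,3)] by auto
    have "- I \<le> integral {\<tau>..t} K"
    proof (rule has_integral_le)
      show "((\<lambda>x. - (x\<^sup>2 / 2 * exp (121 / 50 - 5 * (x / \<tau>)))) has_integral - I) {\<tau>..t}"
        by (intro has_integral_neg I)
      show "(K has_integral integral {\<tau>..t} K) {\<tau>..t}"
        using sub[of \<tau> t] \<tau> pi3 by (auto simp: has_integral_integral)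
      fix x assume x: "x \<in> {\<tau>..t}"
      define y where "y = x / \<tau>"
      have y: "1 \<le> y" "x = \<tau> * y" using x \<tau> by (auto simp: y_def)
      have x2: "x\<^sup>2 = t\<^sup>2 * (t * y\<^sup>2)" by (simp add: y(2) power_mult_distrib \<tau>(2)) (simp add: eval_nat_numeral)
      have "x\<^sup>2 \<le> t\<^sup>2" using x \<tau> by (intro power_mono) auto
      then have ty: "t * y\<^sup>2 \<le> 1" using t by (simp add: x2 mult_le_cancel_left1)
      have "5 * y - 121 / 50 \<le> 3 * (19 / 20 * y\<^sup>2 / (1 + 19 / 20 * (t * y\<^sup>2)))"
        using t y ty by (intro tail_exponent_ge)
      also have "\<dots> = 3 / t * (19 / 20 * x\<^sup>2 / (t\<^sup>2 + 19 / 20 * x\<^sup>2))"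
      proof -
        have "19 / 20 * x\<^sup>2 / (t\<^sup>2 + 19 / 20 * x\<^sup>2) = (t\<^sup>2 * (19 / 20 * (t * y\<^sup>2))) / (t\<^sup>2 * (1 + 19 / 20 * (t * y\<^sup>2)))"
          by (simp add: x2 algebra_simps)
        also have "\<dots> = 19 / 20 * (t * y\<^sup>2) / (1 + 19 / 20 * (t * y\<^sup>2))"
          by (rule mult_divide_mult_cancel_left) (use t in auto)
        finally show ?thesis using t by simp
      qed
      also have "\<dots> \<le> ldec r x" unfolding r_def using t x \<tau> by (intro ldec_ge_near) auto
      finally have "exp (- ldec r x) \<le> exp (121 / 50 - 5 * y)" by simp
      from K_ge[OF this] have "- (exp (121 / 50 - 5 * y) * (1 - cos x)) \<le> K x" .
      moreover have "exp (121 / 50 - 5 * y) * (1 - cos x) \<le> exp (121 / 50 - 5 * y) * (x\<^sup>2 / 2)"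
        by (intro mult_left_mono one_minus_cos_le) auto
      ultimately have "- (exp (121 / 50 - 5 * y) * (x\<^sup>2 / 2)) \<le> K x" by linarith
      then show "- (x\<^sup>2 / 2 * exp (121 / 50 - 5 * (x / \<tau>))) \<le> K x" by (simp only: y_def mult.commute)
    qed
    then show ?thesis using I by linarith
  qed

  have const: "- (c * (b - a)) \<le> integral {a..b} K" 
    if "0 \<le> a" "a \<le> b" "b \<le> pi" "\<And>x. x \<in> {a..b} \<Longrightarrow> - c \<le> K x" for a b c
  proof (rule has_integral_le)
    show "((\<lambda>x. - c) has_integral - (c * (b - a))) {a..b}"
      using has_integral_const_real[of "- c" a b] that by (simp add: algebra_simps)
    show "(K has_integral integral {a..b} K) {a..b}"
      using sub[of a b] that by (auto simp: has_integral_integral)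
  qed (use that in auto)

  have p3: "- (exp (- (73 / 50 / t)) * (9 / 2 * t\<^sup>2) * (3 * t - t)) \<le> integral {t..3 * t} K"
  proof (rule const)
    fix x assume x: "x \<in> {t..3 * t}"
    have "exp (- ldec r x) \<le> exp (- (73 / 50 / t))" using ldec_ge_mid[of t x] t x by (simp add: r_def)
    from K_ge[OF this] have "- (exp (- (73 / 50 / t)) * (1 - cos x)) \<le> K x" .
    moreover have "1 - cos x \<le> 9 / 2 * t\<^sup>2"
    proof -
      have "x\<^sup>2 \<le> (3 * t)\<^sup>2" using x t by (intro power_mono) auto
      then show ?thesis using one_minus_cos_le[of x] by (simp add: power_mult_distrib)
    qed
    then have "exp (- (73 / 50 / t)) * (1 - cos x) \<le> exp (- (73 / 50 / t)) * (9 / 2 * t\<^sup>2)"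
      by (intro mult_left_mono) auto
    ultimately show "- (exp (- (73 / 50 / t)) * (9 / 2 * t\<^sup>2)) \<le> K x" by linarith
  qed (use t pi3 in auto)

  have p4: "- (exp (- (179 / 100 / t)) * 2 * (pi - 3 * t)) \<le> integral {3 * t..pi} K"
  proof (rule const)
    fix x assume x: "x \<in> {3 * t..pi}"
    have "exp (- ldec r x) \<le> exp (- (179 / 100 / t))" using ldec_ge_far[of t x] t x by (simp add: r_def)
    from K_ge[OF this] have "- (exp (- (179 / 100 / t)) * (1 - cos x)) \<le> K x" .
    moreover have "exp (- (179 / 100 / t)) * (1 - cos x) \<le> exp (- (179 / 100 / t)) * 2"
      using cos_ge_minus_one[of x] by (intro mult_left_mono) auto
    ultimately show "- (exp (- (179 / 100 / t)) * 2) \<le> K x" by linarith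
  qed (use t pi3 in auto)

  have "integral {0..pi} K = integral {0..\<tau>} K + integral {\<tau>..t} K + integral {t..3 * t} K + integral {3 * t..pi} K"
    using Henstock_Kurzweil_Integration.integral_combine[of 0 \<tau> pi K] Henstock_Kurzweil_Integration.integral_combine[of \<tau> t pi K] 
      Henstock_Kurzweil_Integration.integral_combine[of t "3 * t" pi K] sub \<tau> t pi3 int by auto
  moreover have "integral {0..pi} K = pi / 2 * D / M" using intD by (rule integral_unique)
  moreover have "exp (- (73 / 50 / t)) * (9 / 2 * t\<^sup>2) * (3 * t - t) \<le> 1 / 1000 * \<tau> ^ 3"
  proof -
    have "exp (- (73 / 50 / t)) * (9 / 2 * t\<^sup>2) * (3 * t - t) = 9 * t ^ 3 * exp (- (73 / 50 / t))"
      by (simp add: eval_nat_numeral)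
    also have "\<dots> \<le> 9 * t ^ 3 * (1 / 10000 * t\<^sup>2)"
      using t by (intro mult_left_mono exp_neg_inverse_bounds) auto
    also have "\<dots> = 9 / 10000 * (t ^ 4 * t)" by (simp add: eval_nat_numeral)
    also have "\<dots> \<le> 1 / 1000 * (t ^ 4 * s)" using t t_le_s by (intro mult_mono) auto
    also have "t ^ 4 * s = \<tau> ^ 3" using s by (simp add: \<tau>_def power_mult_distrib eval_nat_numeral mult_ac)
    finally show ?thesis .
  qed
  moreover have "exp (- (179 / 100 / t)) * 2 * (pi - 3 * t) \<le> 6 / 1000 * \<tau> ^ 3"
  proof -
    have "exp (- (179 / 100 / t)) * 2 * (pi - 3 * t) \<le> 1 / 500 * t ^ 5 * 2 * 4"
      using t pi_less_4 pi3 by (intro mult_mono exp_neg_inverse_bounds) auto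
    also have "\<dots> = 16 / 1000 * (t ^ 4 * s * s)" using s by (simp add: eval_nat_numeral)
    also have "\<dots> \<le> 16 / 1000 * (t ^ 4 * s * (317 / 1000))" using t s s_le by (intro mult_left_mono) auto
    also have "t ^ 4 * s = \<tau> ^ 3" using s by (simp add: \<tau>_def power_mult_distrib eval_nat_numeral mult_ac)
    finally have "exp (- (179 / 100 / t)) * 2 * (pi - 3 * t) \<le> 16 / 1000 * (\<tau> ^ 3 * (317 / 1000))" .
    moreover have "0 \<le> \<tau> ^ 3" using \<tau> by simp
    ultimately show ?thesis by linarith
  qed
  moreover have "37 / 250 * \<tau> ^ 3 * exp (- 129 / 50) \<le> 12 / 1000 * \<tau> ^ 3"
  proof -
    have "13 \<le> exp (129 / 50 :: real)"
      using sum_le_exp[of "129 / 50" 11] by (simp add: lessThan_nat_numeral lessThan_Suc fact_numeral power_divide)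
    then have "exp (- 129 / 50) \<le> (1 / 13 :: real)" by (simp add: exp_minus field_simps)
    then have "37 / 250 * \<tau> ^ 3 * exp (- 129 / 50) \<le> 37 / 250 * \<tau> ^ 3 * (1 / 13)" using \<tau> by (intro mult_left_mono) auto
    then show ?thesis using \<tau> by simp
  qed
  moreover have "\<tau> ^ 3 > 0" using \<tau> by simp
  \<comment> \<open>In units of \<open>\<tau>\<close>^3 the gain exceeds 0.021 and the losses are at
    most 0.012 + 0.001 + 0.006.\<close>
  ultimately have "0 < pi / 2 * D / M" using p1 p2 p3 p4 by linarith
  then have "0 < D" by (simp add: M_def zero_less_divide_iff zero_less_mult_iff)
  then show ?thesis by (simp add: D_def)
qed

section \<open>Exact computation for small indices\<close>

text \<open>Intermediate value theorem: at r0 = 2^(-1/n) the single term of index n is l(n) n/2 >=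
  n. The first moment bound gives n t^2 <= 15/4, hence t <= 1/10.\<close>

lemma saddle_point_exists:
  assumes n: "n \<ge> 375"
  shows "\<exists>t. 0 < t \<and> t \<le> 1 / 10 \<and> (\<Sum>k. lcf k * real k * exp (- t) ^ k) = real n"
proof -
  define f where "f r = (\<Sum>k. lcf k * real k * r ^ k)" for r :: real
  define r0 where "r0 = root n (1 / 2)"
  have r0: "0 < r0" "r0 < 1" "r0 ^ n = 1 / 2" using n by (auto simp: r0_def)
  have cont: "\<forall>x. 0 \<le> x \<and> x \<le> r0 \<longrightarrow> isCont f x"
  proof (intro allI impI)
    fix x assume x: "0 \<le> x \<and> x \<le> r0"
    define R where "R = (r0 + 1) / 2"
    have R: "0 \<le> R" "R < 1" "r0 < R" using r0 by (auto simp: R_def)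
    have "summable (\<lambda>k. lcf k * real k * R ^ k)" using summable_lcf_moment[OF R(1,2), of 1] by simp
    then show "isCont f x" unfolding f_def by (rule isCont_powser) (use x R in auto)
  qed
  have "f 0 = 0" by (simp add: f_def)
  moreover have "real n \<le> f r0"
  proof -
    have "(\<Sum>k\<in>{n}. lcf k * real k * r0 ^ k) \<le> f r0" unfolding f_def
      by (rule sum_le_suminf) (use summable_lcf_moment[of r0 1] r0 lcf_nonneg in auto)
    moreover have "2 * (real n * (1 / 2)) \<le> lcf n * (real n * (1 / 2))"
      using lcf_ge[of n] n by (intro mult_right_mono) (auto split: if_splits)
    ultimately show ?thesis by (simp add: r0)
  qed
  ultimately obtain r where r: "0 \<le> r" "r \<le> r0" "f r = real n"
    using IVT[of f 0 "real n" r0] cont r0 by auto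
  have r1: "0 < r" "r < 1" using r r0 n \<open>f 0 = 0\<close> by (auto simp: le_less)
  define t where "t = - ln r"
  have t: "0 < t" "exp (- t) = r" using r1 by (auto simp: t_def)
  have "real n \<le> 15 / 4 / t\<^sup>2" using suminf_lcf_moment_le(1)[OF t(1)] r(3) by (simp add: f_def t(2))
  then have "real n * t\<^sup>2 \<le> 15 / 4" using t by (simp add: field_simps)
  moreover have "375 * t\<^sup>2 \<le> real n * t\<^sup>2" using n by (intro mult_right_mono) auto
  ultimately have "t\<^sup>2 \<le> (1 / 10)\<^sup>2" by (simp add: power2_eq_square)
  then have "t \<le> 1 / 10" by (rule power2_le_imp_le) simp
  then show ?thesis using t r(3) by (auto simp: f_def intro!: exI[of _ t])
qed

lemma acoef_log_concave_large:
  assumes n: "n \<ge> 375"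
  shows "acoef (n + 1) * acoef (n - 1) < acoef n ^ 2"
proof -
  obtain t where t: "0 < t" "t \<le> 1 / 10" "(\<Sum>k. lcf k * real k * exp (- t) ^ k) = real n"
    using saddle_point_exists[OF n] by blast
  define r where "r = exp (- t)"
  have r: "r > 0" by (simp add: r_def)
  define u v w where "u = acoef n * r ^ n" and "v = acoef (n + 1) * r ^ (n + 1)" and "w = acoef (n - 1) * r ^ (n - 1)"
  have nonneg: "0 \<le> u" "0 \<le> v" "0 \<le> w" using r acoef_nonneg by (auto simp: u_def v_def w_def)
  have lt: "v + w < 2 * u" using tilted_concavity[OF t] n by (simp add: u_def v_def w_def r_def mult_ac)
  have "(v + w)\<^sup>2 < (2 * u)\<^sup>2" by (rule power_strict_mono[OF lt]) (use nonneg in auto)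
  moreover have "4 * (v * w) \<le> (v + w)\<^sup>2" using zero_le_power2[of "v - w"] by (simp add: power2_eq_square algebra_simps)
  ultimately have "v * w < u\<^sup>2" by (simp add: power_mult_distrib)
  moreover have "v * w = (acoef (n + 1) * acoef (n - 1)) * (r ^ n)\<^sup>2"
  proof -
    have "(n + 1) + (n - 1) = n + n" using n by simp
    then have "r ^ (n + 1) * r ^ (n - 1) = (r ^ n)\<^sup>2" unfolding power2_eq_square by (metis power_add)
    then show ?thesis by (simp only: v_def w_def) (simp add: mult_ac)
  qed
  moreover have "u\<^sup>2 = acoef n ^ 2 * (r ^ n)\<^sup>2" by (simp add: u_def power_mult_distrib)
  ultimately show ?thesis using r by (simp add: mult_less_cancel_right)
qed

text \<open>
  Symbolic evaluation takes time linear in the length of the lists only if all recursion is tail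
  recursion and no list occurs in the branches of a conditional.
\<close>

fun dot :: "int \<Rightarrow> int list \<Rightarrow> int list \<Rightarrow> int" where
  "dot a [] ys = a"
| "dot a (x # xs) [] = a"
| "dot a (x # xs) (y # ys) = dot (a + x * y) xs ys"

text \<open>The computed coefficients are stored in descending order; the list is cleared if a division is not exact.\<close>

fun extend :: "int \<Rightarrow> int \<Rightarrow> int list \<Rightarrow> int list" where
  "extend n d [] = []"
| "extend n d (b # bs) = (if d mod n = 0 then - (d div n) # b # bs else [])"

text \<open>Solves n b(n) = - (sum of k l(k) b(n - k)) for the reciprocal series. \<open>cs\<close>
  is ascending and \<open>bs\<close> descending, so \<open>dot\<close> is a convolution; the list
  consumed by the recursion counts the steps.\<close>

fun inverse_coeffs :: "int list \<Rightarrow> int \<Rightarrow> int list \<Rightarrow> int list \<Rightarrow> int list" where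
  "inverse_coeffs cs n [] bs = bs"
| "inverse_coeffs cs n (c # ds) bs = inverse_coeffs cs (n + 1) ds (extend n (dot 0 cs bs) bs)"

fun coeffs :: "int list \<Rightarrow> int list \<Rightarrow> int list \<Rightarrow> int list" where
  "coeffs bs [] as = as"
| "coeffs bs (c # cs) as = coeffs bs cs (- dot 0 bs as # as)"

text \<open>This is the integer k l(k), with the odd divisors enumerated as 2 j + 1. For even k both
  summands of \<open>lcf\<close> are equal by \<open>lam_double\<close>, hence 4 instead of
  2.\<close>

definition log_deriv_coeff :: "int \<Rightarrow> int" where
  "log_deriv_coeff k = (if even k then 4 else 2) *
     fold (\<lambda>j s. if (2 * j + 1) dvd k then s + k div (2 * j + 1) else s) [0..k div 2] 0"

text \<open>The result is accumulated in \<open>P\<close> to keep the recursion tail recursive.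
  \<open>k\<close> is the index of the middle entry \<open>y\<close>; indices below 10 pass without
  a test.\<close>

fun log_concave_from :: "bool \<Rightarrow> int \<Rightarrow> int list \<Rightarrow> bool" where
  "log_concave_from P k (x # y # z # xs) =
     log_concave_from (P \<and> (k < 10 \<or> x * z < y * y)) (k - 1) (y # z # xs)"
| "log_concave_from P k xs = P"

text \<open>Reversing \<open>bs\<close> and dropping b(0) gives the ascending list from b(1) on that
  the recurrence for a(n) consumes. The largest tested index is N - 1.\<close>

definition log_concave_check :: "int \<Rightarrow> bool" where
  "log_concave_check N = (let cs = map log_deriv_coeff [1..N]; bs = inverse_coeffs cs 1 cs [1]
     in bs \<noteq> [] \<and> log_concave_from True (N - 1) (coeffs (tl (rev bs)) cs [1]))"

section \<open>Correctness of the computation\<close>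

text \<open>The coefficients of exp (-L q). Through them a(n) satisfies a recurrence with small
  integer multipliers and without division.\<close>

definition bcoef :: "nat \<Rightarrow> real" where "bcoef n = fps_nth (inverse (Abs_fps acoef)) n"

lemma acoef_fps_inverse: "Abs_fps acoef * inverse (Abs_fps acoef) = 1"
  by (rule inverse_mult_eq_1') (simp add: acoef_0)

lemma bcoef_0: "bcoef 0 = 1" by (simp add: bcoef_def acoef_0)

text \<open>Differentiate A B = 1 and insert A' = L' A; the result is B' = -L' B.\<close>

lemma bcoef_rec:
  "real (Suc n) * bcoef (Suc n) = - (\<Sum>i\<le>n. real (Suc i) * lcf (Suc i) * bcoef (n - i))"
proof -
  define A where "A = Abs_fps acoef"
  define B where "B = inverse A"
  define L where "L = fps_deriv (Abs_fps lcf)"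
  have AB: "A * B = 1" using acoef_fps_inverse by (simp add: A_def B_def)
  have "fps_deriv (A * B) = 0" by (simp add: AB)
  then have "A * fps_deriv B + L * (A * B) = 0"
    using acoef_fps_deriv by (simp add: A_def L_def algebra_simps)
  then have "B * (A * fps_deriv B + L) = 0" by (simp add: AB)
  then have "(A * B) * fps_deriv B + L * B = 0" by (simp add: algebra_simps)
  then have "fps_deriv B = - (L * B)" by (simp add: AB add_eq_0_iff2)
  then have "fps_nth (fps_deriv B) n = - fps_nth (L * B) n" by simp
  moreover have "fps_nth B k = bcoef k" for k by (simp add: B_def A_def bcoef_def)
  ultimately show ?thesis by (simp add: fps_mult_nth L_def atLeast0AtMost)
qed

lemma acoef_rec: "acoef (Suc n) = - (\<Sum>i\<le>n. bcoef (Suc i) * acoef (n - i))"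
proof -
  have "inverse (Abs_fps acoef) * Abs_fps acoef = 1" using acoef_fps_inverse by (simp add: mult.commute)
  then have "fps_nth (inverse (Abs_fps acoef) * Abs_fps acoef) (Suc n) = 0" by simp
  then have "(\<Sum>i\<le>Suc n. bcoef i * acoef (Suc n - i)) = 0"
    by (simp add: fps_mult_nth atLeast0AtMost bcoef_def)
  then show ?thesis unfolding sum.atMost_Suc_shift by (simp add: bcoef_0 add_eq_0_iff2)
qed

lemma lam_double: "lam (2 * k) = lam k"
proof -
  have "m dvd 2 * k \<longleftrightarrow> m dvd k" if "odd m" for m
    using that by (intro coprime_dvd_mult_right_iff) simp
  then have "{m. m dvd 2 * k \<and> odd m} = {m. m dvd k \<and> odd m}" by auto
  then show ?thesis by (simp add: lam_def)
qed

lemma log_deriv_coeff_eq: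
  assumes "k > 0"
  shows "real_of_int (log_deriv_coeff (int k)) = real k * lcf k"
proof -
  have fold_eq: "fold (\<lambda>j s. if P j then s + g j else s) xs a = a + sum_list (map (\<lambda>j. if P j then g j else 0) xs)"
    for P and g :: "int \<Rightarrow> int" and xs a
    by (induction xs arbitrary: a) auto
  have "sum_list (map (\<lambda>j. if (2 * j + 1) dvd int k then int k div (2 * j + 1) else 0) [0..int k div 2]) =
      (\<Sum>j\<in>{0..int k div 2}. if (2 * j + 1) dvd int k then int k div (2 * j + 1) else 0)"
    by (subst sum_list_distinct_conv_sum_set) auto
  also have "\<dots> = (\<Sum>j\<in>{j \<in> {0..int k div 2}. (2 * j + 1) dvd int k}. int k div (2 * j + 1))"
    by (rule sum.inter_filter[symmetric]) auto
  also have "\<dots> = (\<Sum>m | m dvd k \<and> odd m. int (k div m))"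
  proof (rule sum.reindex_bij_witness[where i = "\<lambda>m. int (m div 2)" and j = "\<lambda>j. nat (2 * j + 1)"])
    fix m assume m: "m \<in> {m. m dvd k \<and> odd m}"
    then have odd: "2 * int (m div 2) + 1 = int m" by (auto elim!: oddE)
    have "m \<le> k" using m assms by (auto dest: dvd_imp_le)
    then have "m div 2 \<le> k div 2" by (rule div_le_mono)
    then show "int (m div 2) \<in> {j \<in> {0..int k div 2}. (2 * j + 1) dvd int k}"
      using m odd by (auto simp flip: of_nat_div simp: zdiv_int[of k 2])
    show "nat (2 * int (m div 2) + 1) = m" using odd by simp
  next
    fix j assume "j \<in> {j \<in> {0..int k div 2}. (2 * j + 1) dvd int k}"
    then have j: "0 \<le> j" "(2 * j + 1) dvd int k" by auto
    define m where "m = nat (2 * j + 1)"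
    have m: "int m = 2 * j + 1" using j by (simp add: m_def)
    have "int (m div 2) = j" using m by (simp add: zdiv_int)
    then show "int (nat (2 * j + 1) div 2) = j" by (simp add: m_def)
    have "odd (int m)" by (simp add: m)
    moreover have "int m dvd int k" using j m by simp
    ultimately show "nat (2 * j + 1) \<in> {m. m dvd k \<and> odd m}" unfolding m_def[symmetric] by simp
    show "int (k div nat (2 * j + 1)) = int k div (2 * j + 1)"
      unfolding m_def[symmetric] by (simp add: zdiv_int m)
  qed
  finally have "real_of_int (sum_list (map (\<lambda>j. if (2 * j + 1) dvd int k then int k div (2 * j + 1) else 0) [0..int k div 2])) =
      (\<Sum>m | m dvd k \<and> odd m. real (k div m))" by simp
  also have "\<dots> = (\<Sum>m | m dvd k \<and> odd m. real k / 2 * (2 / real m))"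
    by (intro sum.cong) (auto simp: real_of_nat_div)
  also have "\<dots> = real k / 2 * lam k" unfolding lam_def by (rule sum_distrib_left[symmetric])
  finally have "real_of_int (log_deriv_coeff (int k)) = (if even k then 4 else 2) * (real k / 2 * lam k)"
    by (simp add: log_deriv_coeff_def fold_eq mult_ac)
  also have "\<dots> = real k * lcf k" using lam_double[of "k div 2"] by (auto simp: lcf_def)
  finally show ?thesis .
qed

primrec desc :: "(nat \<Rightarrow> real) \<Rightarrow> nat \<Rightarrow> real list" where
  "desc f 0 = []"
| "desc f (Suc n) = f n # desc f n"

text \<open>An ascending list against a descending one: the inner product is a coefficient of the
  Cauchy product.\<close>

lemma dot_desc:
  assumes "map of_int xs = map g [s..<s + length xs]" "map of_int ys = desc f n" "n \<le> length xs"
  shows "of_int (dot a xs ys) = of_int a + (\<Sum>i<n. g (s + i) * f (n - 1 - i))"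
  using assms
proof (induction a xs ys arbitrary: s n rule: dot.induct)
  case (1 a ys)
  then show ?case by simp
next
  case (2 a x xs)
  then have "n = 0" by (cases n) auto
  then show ?case by simp
next
  case (3 a x xs y ys)
  from "3.prems"(2) obtain m where n: "n = Suc m" by (cases n) auto
  have "[s..<s + length (x # xs)] = s # [Suc s..<Suc s + length xs]" by (subst upt_conv_Cons) auto
  then have x: "of_int x = g s" and xs: "map of_int xs = map g [Suc s..<Suc s + length xs]"
    using "3.prems"(1) by auto
  have y: "of_int y = f m" and ys: "map of_int ys = desc f m" using "3.prems"(2) by (auto simp: n)
  have m: "m \<le> length xs" using "3.prems"(3) by (simp add: n)
  have "of_int (dot a (x # xs) (y # ys)) = of_int (a + x * y) + (\<Sum>i<m. g (Suc s + i) * f (m - 1 - i))"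
    using "3.IH"[OF xs ys m] by simp
  also have "\<dots> = of_int a + (g s * f m + (\<Sum>i<m. g (Suc s + i) * f (m - 1 - i)))" using x y by simp
  also have "g s * f m + (\<Sum>i<m. g (Suc s + i) * f (m - 1 - i)) = (\<Sum>i<n. g (s + i) * f (n - 1 - i))"
    unfolding n sum.lessThan_Suc_shift by simp
  finally show ?case .
qed

lemma inverse_coeffs_Nil [simp]: "inverse_coeffs cs n ds [] = []"
  by (induction ds arbitrary: n) auto

text \<open>Exactness of the divisions is checked at run time: the empty list is absorbing, so a
  nonempty result certifies every division.\<close>

lemma inverse_coeffs_correct:
  assumes "map of_int cs = map (\<lambda>k. real k * lcf k) [1..<1 + length cs]"
    and "map of_int bs = desc bcoef (Suc n)" "n + length ds \<le> length cs"
    and "inverse_coeffs cs (int (Suc n)) ds bs \<noteq> []"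
  shows "map of_int (inverse_coeffs cs (int (Suc n)) ds bs) = desc bcoef (Suc (n + length ds))"
  using assms(2-)
proof (induction ds arbitrary: n bs)
  case Nil
  then show ?case by simp
next
  case (Cons d ds)
  define e where "e = dot 0 cs bs"
  obtain b bs' where bs: "bs = b # bs'" using Cons.prems(1) by (auto simp: map_eq_Cons_conv)
  have step: "inverse_coeffs cs (int (Suc n)) (d # ds) bs =
      inverse_coeffs cs (int (Suc (Suc n))) ds (if e mod int (Suc n) = 0 then - (e div int (Suc n)) # bs else [])"
    by (simp add: e_def bs add_ac)
  have e_mod: "e mod int (Suc n) = 0" using Cons.prems(3) unfolding step by (auto split: if_splits)
  then have e_div: "e = int (Suc n) * (e div int (Suc n))" by (metis mult_div_mod_eq add.right_neutral)
  have "real_of_int e = of_int 0 + (\<Sum>i<Suc n. real (1 + i) * lcf (1 + i) * bcoef (Suc n - 1 - i))"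
    unfolding e_def by (rule dot_desc[OF assms(1) Cons.prems(1)]) (use Cons.prems in auto)
  also have "\<dots> = - (real (Suc n) * bcoef (Suc n))"
    unfolding bcoef_rec by (simp add: lessThan_Suc_atMost)
  finally have "real (Suc n) * real_of_int (e div int (Suc n)) = - (real (Suc n) * bcoef (Suc n))"
    by (subst (asm) e_div) simp
  then have "real (Suc n) * (real_of_int (e div int (Suc n)) + bcoef (Suc n)) = 0" by (simp add: distrib_left)
  then have "real_of_int (- (e div int (Suc n))) = bcoef (Suc n)" by (simp add: add_eq_0_iff2)
  then have "map of_int (- (e div int (Suc n)) # bs) = desc bcoef (Suc (Suc n))"
    using Cons.prems(1) by simp
  from Cons.IH[OF this] Cons.prems e_mod show ?case unfolding step by simp
qed

lemma coeffs_correct: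
  assumes "map of_int bs = map bcoef [1..<1 + length bs]"
    and "map of_int as = desc acoef (Suc n)" "n + length cs \<le> length bs"
  shows "map of_int (coeffs bs cs as) = desc acoef (Suc (n + length cs))"
  using assms(2-)
proof (induction cs arbitrary: n as)
  case Nil
  then show ?case by simp
next
  case (Cons c cs)
  have "real_of_int (dot 0 bs as) = of_int 0 + (\<Sum>i<Suc n. bcoef (1 + i) * acoef (Suc n - 1 - i))"
    by (rule dot_desc[OF assms(1) Cons.prems(1)]) (use Cons.prems in auto)
  also have "\<dots> = - acoef (Suc n)" unfolding acoef_rec by (simp add: lessThan_Suc_atMost)
  finally have "map of_int (- dot 0 bs as # as) = desc acoef (Suc (Suc n))"
    using Cons.prems(1) by simp
  from Cons.IH[OF this] Cons.prems show ?case by simp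
qed

lemma log_concave_from_imp: "log_concave_from P k xs \<Longrightarrow> P"
  by (induction P k xs rule: log_concave_from.induct) auto

lemma log_concave_from_correct:
  assumes "log_concave_from P (int m) xs" "map of_int xs = desc f (Suc (Suc m))" "10 \<le> n" "n \<le> m"
  shows "f (n + 1) * f (n - 1) < f n ^ 2"
  using assms
proof (induction m arbitrary: P xs)
  case 0
  then show ?case by simp
next
  case (Suc m)
  obtain x y z ys where xs: "xs = x # y # z # ys" and xyz: "of_int x = f (Suc (Suc m))" "of_int y = f (Suc m)" "of_int z = f m"
    and tl: "map of_int (y # z # ys) = desc f (Suc (Suc m))"
    using Suc.prems(2) by (auto simp: map_eq_Cons_conv)
  have 10: "log_concave_from (P \<and> (int (Suc m) < 10 \<or> x * z < y * y)) (int m) (y # z # ys)"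
    using Suc.prems(1) by (simp add: xs)
  have "x * z < y * y" using log_concave_from_imp[OF 10] Suc.prems(3,4) by auto
  show ?case
  proof (cases "n = Suc m")
    case True
    have "real_of_int (x * z) < real_of_int (y * y)" using \<open>x * z < y * y\<close> by (simp only: of_int_less_iff)
    then show ?thesis using xyz by (simp add: True power2_eq_square)
  next
    case False
    then show ?thesis using Suc.IH[OF 10 tl Suc.prems(3)] Suc.prems(4) by simp
  qed
qed

lemma log_concave_check_correct:
  assumes check: "log_concave_check (int (Suc N))" and n: "10 \<le> n" "n \<le> N"
  shows "acoef (n + 1) * acoef (n - 1) < acoef n ^ 2"
proof -
  define cs where "cs = map log_deriv_coeff [1..int (Suc N)]"
  define bs where "bs = inverse_coeffs cs 1 cs [1]"
  have len: "length cs = Suc N" by (simp add: cs_def)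
  have "[1..int (Suc N)] = map int [1..<1 + Suc N]"
    by (rule nth_equalityI) (auto simp del: upt_Suc)
  then have cs: "map of_int cs = map (\<lambda>k. real k * lcf k) [1..<1 + length cs]"
    unfolding len by (auto simp: cs_def log_deriv_coeff_eq o_def simp del: upt_Suc)
  have bs_ne: "bs \<noteq> []" and lc: "log_concave_from True (int N) (coeffs (tl (rev bs)) cs [1])"
    using check by (auto simp: log_concave_check_def Let_def cs_def bs_def)
  have "map of_int (inverse_coeffs cs (int (Suc 0)) cs [1]) = desc bcoef (Suc (0 + length cs))"
    by (rule inverse_coeffs_correct[OF cs]) (use bs_ne in \<open>auto simp: bs_def bcoef_0\<close>)
  then have bs: "map of_int bs = desc bcoef (Suc (Suc N))" by (simp add: bs_def len)
  have rev_desc: "rev (desc f n) = map f [0..<n]" for f n by (induction n) auto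
  have "map of_int (rev bs) = map bcoef [0..<Suc (Suc N)]"
    using rev_desc[of bcoef "Suc (Suc N)"] by (simp only: rev_map[symmetric] bs)
  then have "tl (map of_int (rev bs)) = tl (map bcoef (0 # [1..<Suc (Suc N)]))"
    by (simp only: upt_conv_Cons[of 0 "Suc (Suc N)"] zero_less_Suc One_nat_def)
  then have tl: "map of_int (tl (rev bs)) = map bcoef [1..<1 + Suc N]"
    by (simp only: map_tl list.map list.sel plus_1_eq_Suc)
  have "length (tl (rev bs)) = Suc N" using arg_cong[OF tl, of length] by (simp del: upt_Suc)
  then have "map of_int (coeffs (tl (rev bs)) cs [1]) = desc acoef (Suc (0 + length cs))"
    using tl len by (intro coeffs_correct) (auto simp: acoef_0 simp del: upt_Suc)
  then show ?thesis using log_concave_from_correct[OF lc _ n] by (simp add: len)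
qed

text \<open>Covers the indices from 10 to 374, up to where \<open>acoef_log_concave_large\<close>
  takes over. \<open>code_simp\<close> evaluates by rewriting within the kernel.\<close>

lemma log_concave_check_375: "log_concave_check 375"
  by code_simp

theorem theorem2p4:
  fixes n :: nat
  assumes "n \<ge> 10"
  shows "cubic_overpartition n ^ 2 > cubic_overpartition (n + 1) * cubic_overpartition (n - 1)"
proof (cases "n \<ge> 375")
  case True
  then show ?thesis using acoef_log_concave_large by (simp add: cubic_overpartition_eq)
next
  case False
  have "log_concave_check (int (Suc 374))" using log_concave_check_375 by simp
  from log_concave_check_correct[OF this assms] False
  show ?thesis by (simp add: cubic_overpartition_eq)
qed

end
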